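(* Consider the operator $$F(u)=\sum_{i=1}^{N-1}u_{x_ix_i}+g(u_{x_N}^2)\,u_{x_Nx_N},$$ where $g:[0,+\infty)\to[0,+\infty)$ is a continuous function satisfying assumptions (L) and (G), and let $\overline t$ be the number in (L). Assume that $\int_0^\xi\frac{g(\zeta^2/N)}{\zeta}\,d\zeta<+\infty$ (for $\xi>0$) and that on $(0,\overline t]$ $$g'(t)>0\quad\text{and}\quad g(t)+g'(t)t\le1 .$$ If $$\lim_{t\to0^+}\frac{(g(t))^{3/2}}{t\,g'(t)}=0,$$ then there exist an open regular region $\Omega\subset\mathbb{R}^N$, a point $z\in\partial\Omega$, and a radial function $u\in C^2(\Omega)$ (extending continuously to $z$) such that $F(u)\le0$ in $\Omega$, $u(z)=0$, $u(z)<u(x)$ for every $x\in\Omega$, and $$\frac{\partial u}{\partial\nu}(z)=0,$$ where $\nu$ is the outer unit normal to $\Omega$ at $z$. If, in addition, $\dfrac{g(t)}{t\,g'(t)}$ is bounded in $(0,\overline t]$, then $\Omega$, $u$, $z$ can be taken so that, moreover, $\Omega$ satisfies the interior ball condition at $z$.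
   Context: Throughout $N\ge 2$. Assumptions (L) for $g$: there exists $\overline t>0$ such that $0\le g(t)\le1$ on $[0,\overline t]$; $g$ is continuous on $[0,\overline t]$, and positive and differentiable on $(0,\overline t]$; and on $(0,\overline t]$ the function $t\mapsto g(t)+g'(t)t$ is non-decreasing. Assumption (G) for $g$: a solution $f$ on $[0,+\infty)$ of the differential equation $g(t)=f(t)+5tf'(t)+2t^2f''(t)$ is bounded, and the function $s\mapsto f(s^2)s^2$ is strictly convex on $\mathbb{R}$. A regular region is a connected, open and bounded set $\Omega\subset\mathbb{R}^N$ such that at every $z\in\partial\Omega$ there exists a tangent plane to $\partial\Omega$, depending continuously on $z$. $\Omega$ satisfies the interior ball condition at $z\in\partial\Omega$ if there exists an open ball $B\subset\Omega$ with $z\in\partial B$. A radial function is one depending only on $\rho=|x|$. The normal derivative at the boundary point $z$ is the one-sided derivative $\frac{\partial u}{\partial\nu}(z)=\lim_{h\to0^+}\frac{u(z)-u(z-h\nu)}{h}$. *)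

theory Defs
  imports "HOL-Analysis.Analysis"
begin

definition strictly_convex_on :: "'a::real_vector set \<Rightarrow> ('a \<Rightarrow> real) \<Rightarrow> bool" where
  "strictly_convex_on S f \<longleftrightarrow> convex S \<and>
     (\<forall>x\<in>S. \<forall>y\<in>S. \<forall>t. x \<noteq> y \<and> 0 < t \<and> t < 1 \<longrightarrow>
        f ((1 - t) *\<^sub>R x + t *\<^sub>R y) < (1 - t) * f x + t * f y)"

text \<open>The function \<open>g'\<close> is the derivative of \<open>g\<close> on the half-open interval; at the
  endpoint \<open>tb\<close> only the one-sided derivative is required.\<close>

definition assumption_L :: "(real \<Rightarrow> real) \<Rightarrow> (real \<Rightarrow> real) \<Rightarrow> real \<Rightarrow> bool" where
  "assumption_L g g' tb \<longleftrightarrow>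
     0 < tb \<and>
     (\<forall>t\<in>{0..tb}. 0 \<le> g t \<and> g t \<le> 1) \<and>
     continuous_on {0..tb} g \<and>
     (\<forall>t\<in>{0<..tb}. 0 < g t) \<and>
     (\<forall>t\<in>{0<..tb}. (g has_real_derivative g' t) (at t within {0<..tb})) \<and>
     mono_on {0<..tb} (\<lambda>t. g t + g' t * t)"

text \<open>The differential equation is singular at \<open>t = 0\<close>: a bounded solution is in general
  not differentiable there. A solution on the closed half-line is therefore continuous up to
  \<open>0\<close> and twice differentiable for \<open>t > 0\<close>; at \<open>t = 0\<close> the equation reads
  \<open>g 0 = f 0\<close>.\<close>

definition assumption_G :: "(real \<Rightarrow> real) \<Rightarrow> bool" where
  "assumption_G g \<longleftrightarrow>
     (\<exists>f f' f''. continuous_on {0..} f \<and>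
        (\<forall>t>0. (f has_real_derivative f' t) (at t)) \<and>
        (\<forall>t>0. (f' has_real_derivative f'' t) (at t)) \<and>
        (\<forall>t\<ge>0. g t = f t + 5 * t * f' t + 2 * t\<^sup>2 * f'' t) \<and>
        bounded (f ` {0..}) \<and>
        strictly_convex_on UNIV (\<lambda>s::real. f (s\<^sup>2) * s\<^sup>2))"

text \<open>The Bouligand (contingent) tangent cone of a set at a point.\<close>

definition tangent_cone :: "'a::real_normed_vector set \<Rightarrow> 'a \<Rightarrow> 'a set" where
  "tangent_cone S z =
     {v. \<exists>(X :: nat \<Rightarrow> 'a) (t :: nat \<Rightarrow> real).
           (\<forall>k. X k \<in> S \<and> 0 < t k) \<and> X \<longlonglongrightarrow> z \<and> t \<longlonglongrightarrow> 0 \<and>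
           (\<lambda>k. (1 / t k) *\<^sub>R (X k - z)) \<longlonglongrightarrow> v}"

text \<open>The boundary has a tangent plane at \<open>z\<close> when its tangent cone there is a hyperplane;
  the outer normal is the unit normal to that plane which points out of the region.\<close>

definition outer_unit_normal :: "'a::euclidean_space set \<Rightarrow> 'a \<Rightarrow> 'a \<Rightarrow> bool" where
  "outer_unit_normal \<Omega> z n \<longleftrightarrow>
     norm n = 1 \<and>
     tangent_cone (frontier \<Omega>) z = {v. n \<bullet> v = 0} \<and>
     (\<exists>\<delta>>0. \<forall>h. 0 < h \<and> h < \<delta> \<longrightarrow> z - h *\<^sub>R n \<in> \<Omega> \<and> z + h *\<^sub>R n \<notin> \<Omega>)"

text \<open>Continuous dependence of the tangent plane on the boundary point is expressed through
  its outer unit normal. This amounts to \<open>\<Omega>\<close> being a bounded domain of class \<open>C\<^sup>1\<close>.\<close>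

definition regular_region :: "'a::euclidean_space set \<Rightarrow> bool" where
  "regular_region \<Omega> \<longleftrightarrow>
     connected \<Omega> \<and> open \<Omega> \<and> bounded \<Omega> \<and>
     (\<exists>n. continuous_on (frontier \<Omega>) n \<and> (\<forall>z\<in>frontier \<Omega>. outer_unit_normal \<Omega> z (n z)))"

definition interior_ball_condition :: "'a::euclidean_space set \<Rightarrow> 'a \<Rightarrow> bool" where
  "interior_ball_condition \<Omega> z \<longleftrightarrow> (\<exists>c r. 0 < r \<and> ball c r \<subseteq> \<Omega> \<and> z \<in> frontier (ball c r))"

definition radial_on :: "'a::real_normed_vector set \<Rightarrow> ('a \<Rightarrow> real) \<Rightarrow> bool" where
  "radial_on S u \<longleftrightarrow> (\<exists>v. \<forall>x\<in>S. u x = v (norm x))"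

definition partial :: "'n \<Rightarrow> (real ^ 'n \<Rightarrow> real) \<Rightarrow> real ^ 'n \<Rightarrow> real" where
  "partial i u x = deriv (\<lambda>h. u (x + h *\<^sub>R axis i 1)) 0"

text \<open>The following two notions are meant for open sets \<open>S\<close>.\<close>

definition C1_on :: "(real ^ 'n) set \<Rightarrow> (real ^ 'n \<Rightarrow> real) \<Rightarrow> bool" where
  "C1_on S u \<longleftrightarrow> u differentiable_on S \<and> (\<forall>i. continuous_on S (partial i u))"

definition C2_on :: "(real ^ 'n) set \<Rightarrow> (real ^ 'n \<Rightarrow> real) \<Rightarrow> bool" where
  "C2_on S u \<longleftrightarrow> C1_on S u \<and> (\<forall>i. C1_on S (partial i u))"

text \<open>The index \<open>k\<close> plays the role of the last coordinate \<open>N\<close>.\<close>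

definition F_op :: "(real \<Rightarrow> real) \<Rightarrow> 'n \<Rightarrow> (real ^ 'n \<Rightarrow> real) \<Rightarrow> real ^ 'n \<Rightarrow> real" where
  "F_op g k u x =
     (\<Sum>i\<in>UNIV - {k}. partial i (partial i u) x)
       + g ((partial k u x)\<^sup>2) * partial k (partial k u) x"

definition has_normal_derivative ::
    "('a::real_normed_vector \<Rightarrow> real) \<Rightarrow> real \<Rightarrow> 'a \<Rightarrow> 'a \<Rightarrow> bool" where
  "has_normal_derivative u d n z \<longleftrightarrow>
     ((\<lambda>h. (u z - u (z - h *\<^sub>R n)) / h) \<longlongrightarrow> d) (at_right 0)"

text \<open>The Hopf lemma fails on \<open>\<Omega>\<close> at the boundary point \<open>z\<close>, as witnessed by the radial
  supersolution \<open>u\<close>.\<close>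

definition hopf_counterexample ::
    "(real \<Rightarrow> real) \<Rightarrow> 'n::finite \<Rightarrow> (real ^ 'n) set \<Rightarrow> real ^ 'n \<Rightarrow> (real ^ 'n \<Rightarrow> real) \<Rightarrow> bool"
  where
  "hopf_counterexample g k \<Omega> z u \<longleftrightarrow>
     regular_region \<Omega> \<and> z \<in> frontier \<Omega> \<and>
     radial_on \<Omega> u \<and> C2_on \<Omega> u \<and> continuous (at z within \<Omega>) u \<and>
     (\<forall>x\<in>\<Omega>. F_op g k u x \<le> 0) \<and>
     u z = 0 \<and> (\<forall>x\<in>\<Omega>. u z < u x) \<and>
     (\<exists>n. outer_unit_normal \<Omega> z n \<and> has_normal_derivative u 0 n z)"

end

theory Submission
  imports Defs
begin

text \<open>Put \<open>s = 1 - norm x\<close> and \<open>u x = W s\<close> with \<open>W 0 = 0\<close>, \<open>W' = p\<close>, where \<open>p\<close> solves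
  \<open>p' = p / (4 g(p\<^sup>2))\<close>. The integrability of \<open>g(\<zeta>\<^sup>2/N)/\<zeta>\<close> makes this equation
  non-unique at 0: there is a solution that is positive for \<open>s > 0\<close> although \<open>p 0 = 0\<close>, so that
  the normal derivative vanishes. Near the axis, where the squared sine of the angle to the
  \<open>k\<close>-th axis is at most \<open>g(p(s)\<^sup>2)\<close>, the term \<open>p'\<close> enters \<open>F u\<close> with a coefficient of order \<open>g(p\<^sup>2)\<close>
  only and is beaten by the curvature term \<open>-p / norm x\<close>. The limit hypothesis says that
  \<open>sqrt (g(p(s)\<^sup>2)) / s\<close> tends to infinity, so this neighbourhood of the axis contains a \<open>C\<^sup>1\<close> region
  tangent to the unit sphere at the pole; if \<open>g/(t g')\<close> is bounded, then \<open>g(p(s)\<^sup>2)\<close> is at least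
  a multiple of \<open>s\<close> and it contains a ball.\<close>

section \<open>Sublevel sets with non-vanishing gradient\<close>

lemma directional_derivative_tendsto:
  fixes H :: "'a::real_inner \<Rightarrow> real"
  assumes "(H has_derivative (\<lambda>v. D \<bullet> v)) (at z)"
  shows "((\<lambda>t. (H (z + t *\<^sub>R w) - H z) / t) \<longlongrightarrow> D \<bullet> w) (at_right 0)"
proof -
  have "((\<lambda>t. H (z + t *\<^sub>R w)) has_derivative (\<lambda>t. D \<bullet> (t *\<^sub>R w))) (at 0)"
    by (rule has_derivative_compose[where f = "\<lambda>t. z + t *\<^sub>R w"])
       (auto intro!: derivative_eq_intros assms)
  then have "((\<lambda>t. H (z + t *\<^sub>R w)) has_real_derivative (D \<bullet> w)) (at 0)"
    by (simp add: has_field_derivative_def mult_commute_abs)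
  then have "((\<lambda>t. (H (z + t *\<^sub>R w) - H z) / t) \<longlongrightarrow> D \<bullet> w) (at 0)"
    by (simp add: DERIV_def)
  then show ?thesis
    using filterlim_at_split by blast
qed

text \<open>Together with its mirror image below, this first-order sign information along rays takes
  the place of the implicit function theorem: zeros of \<open>H\<close> near \<open>z\<close> are
  found by sign changes.\<close>

lemma eventually_pos_along:
  fixes H :: "'a::real_inner \<Rightarrow> real"
  assumes "(H has_derivative (\<lambda>v. D \<bullet> v)) (at z)" "H z = 0" "D \<bullet> w > 0"
  shows "\<forall>\<^sub>F t in at_right 0. H (z + t *\<^sub>R w) > 0"
proof -
  have "\<forall>\<^sub>F t in at_right 0. (H (z + t *\<^sub>R w) - H z) / t > 0"
    using order_tendstoD(1)[OF directional_derivative_tendsto[OF assms(1)] assms(3)] .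
  moreover have "\<forall>\<^sub>F t::real in at_right 0. t > 0"
    by (simp add: eventually_at_right_less)
  ultimately show ?thesis
    by eventually_elim (auto simp: assms zero_less_divide_iff)
qed

lemma eventually_neg_along:
  fixes H :: "'a::real_inner \<Rightarrow> real"
  assumes "(H has_derivative (\<lambda>v. D \<bullet> v)) (at z)" "H z = 0" "D \<bullet> w < 0"
  shows "\<forall>\<^sub>F t in at_right 0. H (z + t *\<^sub>R w) < 0"
proof -
  have "((\<lambda>x. - H x) has_derivative (\<lambda>v. (- D) \<bullet> v)) (at z)"
    using has_derivative_minus[OF assms(1)] by simp
  from eventually_pos_along[OF this, of w] assms show ?thesis by simp
qed

text \<open>Moving from a zero against the gradient makes \<open>H\<close> negative at once, so
  every zero is a limit of sublevel points; conversely, limits of sublevel points satisfy the closed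
  condition \<open>H x \<le> 0\<close>.\<close>

lemma frontier_sublevel:
  fixes H :: "'a::real_inner \<Rightarrow> real"
  assumes der: "\<And>x. (H has_derivative (\<lambda>v. D x \<bullet> v)) (at x)"
    and D: "\<And>x. H x = 0 \<Longrightarrow> D x \<noteq> 0"
  shows "frontier {x. H x < 0} = {x. H x = 0}"
proof -
  have cont: "continuous_on UNIV H"
    using der by (meson continuous_at_imp_continuous_on has_derivative_continuous)
  have op: "open {x. H x < 0}"
    by (intro open_Collect_less cont continuous_intros)
  have cl: "closed {x. H x \<le> 0}"
    by (intro closed_Collect_le cont continuous_intros)
  have fr: "frontier {x. H x < 0} = closure {x. H x < 0} - {x. H x < 0}"
    using op by (simp add: frontier_def interior_open)
  have "closure {x. H x < 0} \<subseteq> {x. H x \<le> 0}"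
    by (rule closure_minimal[OF _ cl]) auto
  moreover have "z \<in> closure {x. H x < 0}" if "H z = 0" for z
  proof -
    have "\<forall>\<^sub>F t in at_right 0. H (z + t *\<^sub>R (- D z)) < 0"
      by (rule eventually_neg_along[OF der that]) (use D[OF that] in simp)
    moreover have "((\<lambda>t. z + t *\<^sub>R (- D z)) \<longlongrightarrow> z + 0 *\<^sub>R (- D z)) (at_right 0)"
      by (intro tendsto_intros)
    ultimately show ?thesis
      by (intro Lim_in_closed_set[where F = "at_right 0" and f = "\<lambda>t. z + t *\<^sub>R (- D z)"])
         (auto elim!: eventually_mono intro: closure_subset[THEN subsetD])
  qed
  ultimately show ?thesis
    unfolding fr by auto
qed

text \<open>Along a sequence in the level set the first-order expansion of \<open>H\<close> says
  that \<open>D \<bullet> (X k - z)\<close> is of smaller order than \<open>norm (X k - z)\<close>;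
  dividing by \<open>t k\<close> and passing to the limit gives the claim.\<close>

lemma tangent_cone_level_subset:
  fixes H :: "'a::real_inner \<Rightarrow> real"
  assumes der: "(H has_derivative (\<lambda>v. D \<bullet> v)) (at z)" and z: "H z = 0"
  shows "tangent_cone {x. H x = 0} z \<subseteq> {v. D \<bullet> v = 0}"
proof
  fix v assume "v \<in> tangent_cone {x. H x = 0} z"
  then obtain X :: "nat \<Rightarrow> 'a" and t :: "nat \<Rightarrow> real"
    where X: "\<And>k. H (X k) = 0" "\<And>k. 0 < t k" "X \<longlonglongrightarrow> z"
      and lim: "(\<lambda>k. (1 / t k) *\<^sub>R (X k - z)) \<longlonglongrightarrow> v"
    unfolding tangent_cone_def by auto
  have lim_inner: "(\<lambda>k. D \<bullet> ((1 / t k) *\<^sub>R (X k - z))) \<longlonglongrightarrow> D \<bullet> v"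
    by (intro tendsto_intros lim)
  have lim_norm: "(\<lambda>k. e * norm ((1 / t k) *\<^sub>R (X k - z))) \<longlonglongrightarrow> e * norm v" for e
    by (intro tendsto_intros lim)
  have "\<bar>D \<bullet> v\<bar> \<le> e * norm v" if e: "e > 0" for e
  proof -
    obtain d where d: "d > 0"
      and dH: "\<And>y. norm (y - z) < d \<Longrightarrow> norm (H y - H z - D \<bullet> (y - z)) \<le> e * norm (y - z)"
      using der e unfolding has_derivative_at_alt by blast
    have "\<forall>\<^sub>F k in sequentially. dist (X k) z < d"
      using X(3) d by (rule tendstoD)
    then have "\<forall>\<^sub>F k in sequentially.
        \<bar>D \<bullet> ((1 / t k) *\<^sub>R (X k - z))\<bar> \<le> e * norm ((1 / t k) *\<^sub>R (X k - z))"
    proof eventually_elim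
      case (elim k)
      then have "\<bar>D \<bullet> (X k - z)\<bar> \<le> e * norm (X k - z)"
        using dH[of "X k"] by (simp add: dist_norm X z)
      then show ?case
        using X(2)[of k] by (simp add: abs_mult divide_simps)
    qed
    then show ?thesis
      by (rule tendsto_le[OF sequentially_bot lim_norm tendsto_rabs[OF lim_inner]])
  qed
  note bound = this
  have "\<bar>D \<bullet> v\<bar> \<le> 0"
  proof (rule field_le_epsilon)
    fix e :: real assume "e > 0"
    \<comment> \<open>The added 1 covers the case \<open>v = 0\<close>.\<close>
    then have "e / (norm v + 1) > 0" by (simp add: add_nonneg_pos)
    note bound[OF this]
    also have "e / (norm v + 1) * norm v \<le> e"
      using \<open>e > 0\<close> by (simp add: divide_simps add_nonneg_pos mult_left_mono)
    finally show "\<bar>D \<bullet> v\<bar> \<le> 0 + e" by simp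
  qed
  then show "v \<in> {v. D \<bullet> v = 0}" by simp
qed

text \<open>For a tangent \<open>v\<close> and small \<open>t\<close>, \<open>H\<close> takes
  opposite signs at \<open>z + t *\<^sub>R (v + c *\<^sub>R D)\<close> and
  \<open>z + t *\<^sub>R (v - c *\<^sub>R D)\<close>. The intermediate value theorem puts a zero
  between them, and letting \<open>c\<close> and \<open>t\<close> shrink yields a sequence in the
  level set with limit direction \<open>v\<close>.\<close>

lemma tangent_cone_level_supset:
  fixes H :: "'a::real_inner \<Rightarrow> real"
  assumes der: "(H has_derivative (\<lambda>v. D \<bullet> v)) (at z)" and cont: "continuous_on UNIV H"
    and z: "H z = 0" and D: "D \<noteq> 0"
  shows "{v. D \<bullet> v = 0} \<subseteq> tangent_cone {x. H x = 0} z"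
proof
  fix v assume "v \<in> {v. D \<bullet> v = 0}"
  then have v: "D \<bullet> v = 0" by simp
  have ex: "\<exists>t w. H (z + t *\<^sub>R w) = 0 \<and> 0 < t \<and> t < e \<and> dist w v \<le> e" if e: "e > 0" for e
  proof -
    \<comment> \<open>With \<open>\<bar>a\<bar> \<le> c\<close>, adding \<open>a *\<^sub>R D\<close>
      changes the direction \<open>v\<close> by at most \<open>c * norm D = e\<close>.\<close>
    define c where "c = e / norm D"
    have c: "c > 0" using e D by (simp add: c_def)
    have pos: "\<forall>\<^sub>F t in at_right 0. H (z + t *\<^sub>R (v + c *\<^sub>R D)) > 0"
      by (rule eventually_pos_along[OF der z]) (use v c D in \<open>simp add: inner_add_right\<close>)
    have neg: "\<forall>\<^sub>F t in at_right 0. H (z + t *\<^sub>R (v + (- c) *\<^sub>R D)) < 0"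
      by (rule eventually_neg_along[OF der z]) (use v c D in \<open>simp add: inner_diff_right\<close>)
    have small: "\<forall>\<^sub>F t in at_right (0::real). t \<in> {0<..<e}"
      using eventually_at_right_real[OF e] .
    from pos neg small have "\<forall>\<^sub>F t in at_right 0. H (z + t *\<^sub>R (v + c *\<^sub>R D)) > 0 \<and>
        H (z + t *\<^sub>R (v + (- c) *\<^sub>R D)) < 0 \<and> t \<in> {0<..<e}"
      by eventually_elim blast
    then obtain t where t: "H (z + t *\<^sub>R (v + c *\<^sub>R D)) > 0"
        "H (z + t *\<^sub>R (v + (- c) *\<^sub>R D)) < 0" "0 < t" "t < e"
      using eventually_happens[of _ "at_right (0::real)"]
      by (metis (mono_tags, lifting) greaterThanLessThan_iff trivial_limit_at_right_real)
    have "continuous_on {-c..c} (\<lambda>a. H (z + t *\<^sub>R (v + a *\<^sub>R D)))"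
      by (rule continuous_on_compose2[OF cont]) (auto intro!: continuous_intros)
    with t c obtain a where a: "-c \<le> a" "a \<le> c" "H (z + t *\<^sub>R (v + a *\<^sub>R D)) = 0"
      using IVT'[of "\<lambda>a. H (z + t *\<^sub>R (v + a *\<^sub>R D))" "-c" 0 c] by auto
    have "dist (v + a *\<^sub>R D) v = \<bar>a\<bar> * norm D"
      by (simp add: dist_norm)
    also have "\<dots> \<le> c * norm D"
      using a by (intro mult_right_mono) auto
    also have "\<dots> = e" using D by (simp add: c_def)
    finally show ?thesis using a t by blast
  qed
  then have "\<forall>k. \<exists>t w. H (z + t *\<^sub>R w) = 0 \<and> 0 < t \<and> t < inverse (real (Suc k)) \<and>
      dist w v \<le> inverse (real (Suc k))"
    by simp
  then obtain t w where tw: "\<And>k. H (z + t k *\<^sub>R w k) = 0" "\<And>k. 0 < t k"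
      "\<And>k. t k < inverse (real (Suc k))" "\<And>k. dist (w k) v \<le> inverse (real (Suc k))"
    by metis
  have inv0: "(\<lambda>k. inverse (real (Suc k))) \<longlonglongrightarrow> 0"
    by (rule LIMSEQ_inverse_real_of_nat)
  have t0: "t \<longlonglongrightarrow> 0"
    by (rule tendsto_sandwich[OF _ _ tendsto_const inv0])
       (use tw in \<open>auto intro!: always_eventually less_imp_le\<close>)
  have "(\<lambda>k. dist (w k) v) \<longlonglongrightarrow> 0"
    by (rule tendsto_sandwich[OF _ _ tendsto_const inv0])
       (use tw(4) in \<open>auto intro!: always_eventually\<close>)
  then have wv: "w \<longlonglongrightarrow> v" by (rule tendsto_dist_iff[THEN iffD2])
  have "(\<lambda>k. z + t k *\<^sub>R w k) \<longlonglongrightarrow> z + 0 *\<^sub>R v"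
    by (intro tendsto_intros t0 wv)
  moreover have "(\<lambda>k. (1 / t k) *\<^sub>R (z + t k *\<^sub>R w k - z)) = w"
    using tw(2) by (auto simp: less_imp_neq[THEN not_sym])
  ultimately show "v \<in> tangent_cone {x. H x = 0} z"
    unfolding tangent_cone_def using tw wv t0
    by (auto intro!: exI[of _ "\<lambda>k. z + t k *\<^sub>R w k"] exI[of _ t])
qed

text \<open>The two inclusions above identify the tangent cone; the sign of \<open>H\<close> along
  the normal line decides which of the two unit normals points outwards.\<close>

lemma outer_unit_normal_sublevel:
  fixes H :: "'a::euclidean_space \<Rightarrow> real"
  assumes der: "\<And>x. (H has_derivative (\<lambda>v. D x \<bullet> v)) (at x)"
    and D: "\<And>x. H x = 0 \<Longrightarrow> D x \<noteq> 0" and z: "H z = 0"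
  shows "outer_unit_normal {x. H x < 0} z (D z /\<^sub>R norm (D z))"
proof -
  let ?n = "D z /\<^sub>R norm (D z)"
  have Dz: "D z \<noteq> 0" using D z by blast
  have cont: "continuous_on UNIV H"
    using der by (meson continuous_at_imp_continuous_on has_derivative_continuous)
  have "tangent_cone {x. H x = 0} z = {v. D z \<bullet> v = 0}"
    using tangent_cone_level_subset[OF der z] tangent_cone_level_supset[OF der cont z Dz] by blast
  then have cone: "tangent_cone (frontier {x. H x < 0}) z = {v. ?n \<bullet> v = 0}"
    using Dz by (simp add: frontier_sublevel[OF der D])
  have pos: "\<forall>\<^sub>F t in at_right 0. H (z + t *\<^sub>R ?n) > 0"
    by (rule eventually_pos_along[OF der z]) (use Dz in \<open>simp add: zero_less_mult_iff\<close>)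
  have neg: "\<forall>\<^sub>F t in at_right 0. H (z + t *\<^sub>R (- ?n)) < 0"
    by (rule eventually_neg_along[OF der z]) (use Dz in \<open>simp add: zero_less_mult_iff\<close>)
  from pos neg have "\<forall>\<^sub>F t in at_right 0. H (z + t *\<^sub>R ?n) > 0 \<and> H (z + t *\<^sub>R (- ?n)) < 0"
    by (rule eventually_conj)
  then obtain d where "d > 0"
      "\<And>t. 0 < t \<Longrightarrow> t < d \<Longrightarrow> H (z + t *\<^sub>R ?n) > 0 \<and> H (z + t *\<^sub>R (- ?n)) < 0"
    unfolding eventually_at_right_field by blast
  then have "\<exists>\<delta>>0. \<forall>h. 0 < h \<and> h < \<delta> \<longrightarrow>
      z - h *\<^sub>R ?n \<in> {x. H x < 0} \<and> z + h *\<^sub>R ?n \<notin> {x. H x < 0}"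
    by (intro exI[of _ d]) fastforce
  then show ?thesis
    unfolding outer_unit_normal_def using cone Dz by simp
qed

lemma regular_region_sublevel:
  fixes H :: "'a::euclidean_space \<Rightarrow> real"
  assumes der: "\<And>x. (H has_derivative (\<lambda>v. D x \<bullet> v)) (at x)"
    and D: "\<And>x. H x = 0 \<Longrightarrow> D x \<noteq> 0" and cont_D: "continuous_on UNIV D"
    and "connected {x. H x < 0}" "bounded {x. H x < 0}"
  shows "regular_region {x. H x < 0}"
proof -
  have cont: "continuous_on UNIV H"
    using der by (meson continuous_at_imp_continuous_on has_derivative_continuous)
  have "continuous_on (frontier {x. H x < 0}) (\<lambda>x. D x /\<^sub>R norm (D x))"
    by (intro continuous_intros continuous_on_subset[OF cont_D])
       (auto simp: frontier_sublevel[OF der D] D)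
  moreover have "open {x. H x < 0}"
    by (intro open_Collect_less cont continuous_intros)
  moreover have "\<forall>z\<in>frontier {x. H x < 0}. outer_unit_normal {x. H x < 0} z (D z /\<^sub>R norm (D z))"
    using outer_unit_normal_sublevel[OF der D] by (simp add: frontier_sublevel[OF der D])
  ultimately show ?thesis
    unfolding regular_region_def using assms(4,5) by blast
qed

section \<open>Profile functions on the half-line\<close>

lemma primitive_of_continuous:
  fixes p :: "real \<Rightarrow> real"
  assumes "continuous_on {0..b} p" "0 < b"
  shows "\<And>s. s \<in> {0<..<b} \<Longrightarrow> ((\<lambda>x. integral {0..x} p) has_real_derivative p s) (at s)"
    and "((\<lambda>s. integral {0..s} p / s) \<longlongrightarrow> p 0) (at_right 0)"
proof -
  show "((\<lambda>x. integral {0..x} p) has_real_derivative p s) (at s)" if "s \<in> {0<..<b}" for s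
    using integral_has_real_derivative[OF assms(1), of s] that
    by (auto simp: at_within_Icc_at)
  show "((\<lambda>s. integral {0..s} p / s) \<longlongrightarrow> p 0) (at_right 0)"
    using integral_has_real_derivative[OF assms(1), of 0] assms(2)
    by (simp add: at_within_Icc_at_right has_field_derivative_iff)
qed

section \<open>Continuously differentiable majorants of first order zero at the origin\<close>

text \<open>The bound \<open>e s\<close> has to be controlled as a function of the value
  \<open>m s\<close>. Since \<open>m\<close> may jump or be locally constant, it is not inverted; a
  supremum of ramp functions, one for each \<open>s\<close>, serves instead.\<close>

lemma continuous_envelope:
  fixes e m :: "real \<Rightarrow> real"
  assumes "0 < S" and m_mono: "mono_on {0<..<S} m"
    and m_pos: "\<And>s. s \<in> {0<..<S} \<Longrightarrow> 0 < m s"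
    and e_nonneg: "\<And>s. s \<in> {0<..<S} \<Longrightarrow> 0 \<le> e s"
    and e_le: "\<And>s. s \<in> {0<..<S} \<Longrightarrow> e s \<le> 1"
    and e_lim: "(e \<longlongrightarrow> 0) (at_right 0)"
  obtains w where "continuous_on {0..} w" "w 0 = 0" "mono_on {0..} w"
    "\<And>r s. s \<in> {0<..<S} \<Longrightarrow> m s \<le> r \<Longrightarrow> e s \<le> w r"
proof -
  \<comment> \<open>As a function of \<open>r \<ge> 0\<close>, \<open>h r s\<close> rises linearly
    from 0 to the height \<open>e s\<close>, reached at \<open>r = m s\<close>, and is constant from
    there on.\<close>
  define h where "h = (\<lambda>r s. e s * min 1 (r / m s))"
  define w where "w = (\<lambda>r. SUP s\<in>{0<..<S}. h r s)"
  have ne: "{0<..<S} \<noteq> {}" using \<open>0 < S\<close> by simp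
  have h_le: "h r s \<le> 1" if "s \<in> {0<..<S}" "r \<ge> 0" for r s
    using that e_nonneg[OF that(1)] e_le[OF that(1)] m_pos[OF that(1)]
    unfolding h_def by (intro mult_le_one) auto
  have bdd: "bdd_above (h r ` {0<..<S})" if "r \<ge> 0" for r
    by (rule bdd_aboveI2[of _ _ 1]) (use h_le that in auto)
  have h_mono: "h r s \<le> h r' s" if "s \<in> {0<..<S}" "r \<le> r'" for r r' s
    unfolding h_def using that m_pos[OF that(1)]
    by (intro mult_left_mono e_nonneg[OF that(1)] min.mono divide_right_mono) auto
  have mono: "w r \<le> w r'" if "0 \<le> r" "r \<le> r'" for r r'
    unfolding w_def using that by (intro cSUP_mono ne bdd) (use h_mono in fastforce)+
  have w0: "w 0 = 0"
    unfolding w_def h_def using ne by simp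
  have w_le: "w r \<le> 1" if "r \<ge> 0" for r
    unfolding w_def using ne h_le that by (intro cSUP_least) auto
  have w_nonneg: "0 \<le> w r" if "r \<ge> 0" for r
    using mono[of 0 r] that w0 by simp
  \<comment> \<open>\<open>w r / r\<close> is non-increasing while \<open>w\<close> is non-decreasing, whence continuity away from 0.\<close>
  have w_scale: "w r' \<le> (r' / r) * w r" if "0 < r" "r \<le> r'" for r r'
    unfolding w_def
  proof (intro cSUP_least ne)
    fix s assume s: "s \<in> {0<..<S}"
    have "min 1 (r' / m s) \<le> (r' / r) * min 1 (r / m s)"
      using that m_pos[OF s] by (auto simp: min_def divide_simps)
    then have "h r' s \<le> e s * ((r' / r) * min 1 (r / m s))"
      unfolding h_def by (intro mult_left_mono e_nonneg[OF s])
    also have "\<dots> = (r' / r) * h r s" by (simp add: h_def)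
    also have "\<dots> \<le> (r' / r) * (SUP s\<in>{0<..<S}. h r s)"
      using that s by (intro mult_left_mono cSUP_upper bdd) auto
    finally show "h r' s \<le> (r' / r) * (SUP s\<in>{0<..<S}. h r s)" .
  qed
  have w_diff: "w r' - w r \<le> (r' - r) / r" if "0 < r" "r \<le> r'" for r r'
  proof -
    have "w r' - w r \<le> ((r' - r) / r) * w r"
      using w_scale[OF that] that by (simp add: field_simps)
    also have "\<dots> \<le> ((r' - r) / r) * 1"
      using that w_le[of r] by (intro mult_left_mono) auto
    finally show ?thesis by simp
  qed
  have cont_pos: "continuous (at a within {0..}) w" if a: "a > 0" for a
    unfolding continuous_within_eps_delta
  proof (intro allI impI)
    fix \<epsilon> :: real assume \<epsilon>: "\<epsilon> > 0"
    \<comment> \<open>The first bound keeps \<open>x\<close> above \<open>a / 2\<close>, so that the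
      denominators coming from \<open>w_diff\<close> are at least \<open>a / 2\<close>; the second
      makes \<open>\<bar>x - a\<bar> / (a / 2)\<close> smaller than
      \<open>\<epsilon>\<close>.\<close>
    define d where "d = min (a / 2) (\<epsilon> * a / 2)"
    have "dist (w x) (w a) < \<epsilon>" if "x \<ge> 0" "dist x a < d" for x
    proof -
      have "\<bar>x - a\<bar> < a / 2" and x2: "\<bar>x - a\<bar> < \<epsilon> * a / 2"
        using that by (auto simp: d_def dist_real_def)
      then have x: "x > a / 2" by linarith
      have "\<bar>w x - w a\<bar> \<le> \<bar>x - a\<bar> / (a / 2)"
      proof (cases "x \<le> a")
        case True
        have "w a - w x \<le> (a - x) / x" using w_diff[of x a] x a True by simp
        also have "\<dots> \<le> (a - x) / (a / 2)" using x a True by (intro divide_left_mono) auto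
        finally show ?thesis using mono[of x a] that True by simp
      next
        case False
        have "w x - w a \<le> (x - a) / a" using w_diff[of a x] a False by simp
        also have "\<dots> \<le> (x - a) / (a / 2)" using a False by (intro divide_left_mono) auto
        finally show ?thesis using mono[of a x] a False by simp
      qed
      also have "\<dots> < \<epsilon>" using x2 a by (simp add: field_simps)
      finally show ?thesis by (simp add: dist_real_def)
    qed
    moreover have "d > 0" using a \<epsilon> by (simp add: d_def)
    ultimately show "\<exists>d>0. \<forall>x\<in>{0..}. dist x a < d \<longrightarrow> dist (w x) (w a) < \<epsilon>" by auto
  qed
  have cont_0: "continuous (at 0 within {0..}) w"
    unfolding continuous_within_eps_delta
  proof (intro allI impI)
    fix \<epsilon> :: real assume \<epsilon>: "\<epsilon> > 0"
    have "\<forall>\<^sub>F s in at_right 0. e s < \<epsilon> / 2"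
      using order_tendstoD(2)[OF e_lim, of "\<epsilon> / 2"] \<epsilon> by simp
    then obtain b where b: "b > 0" "\<And>s. 0 < s \<Longrightarrow> s < b \<Longrightarrow> e s < \<epsilon> / 2"
      unfolding eventually_at_right_field by auto
    \<comment> \<open>Ramps with \<open>s < b\<close> have height below
      \<open>\<epsilon> / 2\<close>. For \<open>s \<ge> b\<close> monotonicity gives
      \<open>m s \<ge> m c\<close>, so the slope is at most \<open>1 / m c\<close>, and the ramp
      stays below \<open>\<epsilon> / 2\<close> as long as \<open>x < d\<close>.\<close>
    define c where "c = min (b / 2) (S / 2)"
    have c: "c > 0" "c < b" "c \<in> {0<..<S}" using b \<open>0 < S\<close> by (auto simp: c_def)
    define d where "d = \<epsilon> / 2 * m c"
    have d: "d > 0" using \<epsilon> m_pos[OF c(3)] by (simp add: d_def)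
    have "dist (w x) (w 0) < \<epsilon>" if "x \<ge> 0" "dist x 0 < d" for x
    proof -
      have "w x \<le> \<epsilon> / 2"
        unfolding w_def
      proof (intro cSUP_least ne)
        fix s assume s: "s \<in> {0<..<S}"
        show "h x s \<le> \<epsilon> / 2"
        proof (cases "s < b")
          case True
          have "h x s \<le> e s * 1"
            unfolding h_def by (intro mult_left_mono e_nonneg[OF s]) auto
          then show ?thesis using b(2)[of s] True s by simp
        next
          case False
          then have "m c \<le> m s" using c s by (intro mono_onD[OF m_mono]) auto
          have "h x s \<le> 1 * (x / m s)"
            unfolding h_def using e_le[OF s] e_nonneg[OF s] m_pos[OF s] that
            by (intro mult_mono) auto
          also have "\<dots> \<le> x / m c"
            using \<open>m c \<le> m s\<close> m_pos[OF c(3)] that by (simp add: frac_le)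
          also have "\<dots> \<le> \<epsilon> / 2" using that m_pos[OF c(3)] by (simp add: d_def field_simps)
          finally show ?thesis .
        qed
      qed
      then show ?thesis using w0 w_nonneg[OF that(1)] \<epsilon> by (simp add: dist_real_def)
    qed
    then show "\<exists>d>0. \<forall>x\<in>{0..}. dist x 0 < d \<longrightarrow> dist (w x) (w 0) < \<epsilon>" using d by auto
  qed
  have "continuous_on {0..} w"
    unfolding continuous_on_eq_continuous_within using cont_0 cont_pos
    by (metis atLeast_iff order_le_less)
  moreover have "mono_on {0..} w" by (intro mono_onI mono) auto
  moreover have "e s \<le> w r" if s: "s \<in> {0<..<S}" and "m s \<le> r" for r s
  proof -
    have "e s = h r s" using that m_pos[OF s] by (simp add: h_def)
    also have "\<dots> \<le> w r"
      unfolding w_def using that m_pos[OF s] by (intro cSUP_upper bdd) auto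
    finally show ?thesis .
  qed
  ultimately show thesis using w0 that by blast
qed

text \<open>\<open>\<Psi>\<close> is a rescaled primitive of the envelope of \<open>s / m s\<close>,
  hence continuously differentiable with \<open>\<Psi> r / r\<close> tending to 0. The last
  conclusion is used in contrapositive form: \<open>\<Psi> r < s\<close> forces
  \<open>r \<le> m s\<close>.\<close>

lemma C1_majorant:
  fixes m :: "real \<Rightarrow> real"
  assumes "0 < S" and m_mono: "mono_on {0<..<S} m"
    and m_pos: "\<And>s. s \<in> {0<..<S} \<Longrightarrow> 0 < m s"
    and le: "\<And>s. s \<in> {0<..<S} \<Longrightarrow> s \<le> m s"
    and lim: "((\<lambda>s. s / m s) \<longlongrightarrow> 0) (at_right 0)"
  obtains \<Psi> \<psi> :: "real \<Rightarrow> real" where "\<Psi> 0 = 0"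
    "\<And>r. r > 0 \<Longrightarrow> (\<Psi> has_real_derivative \<psi> r) (at r)" "mono_on {0..} \<Psi>"
    "((\<lambda>r. \<Psi> r / r) \<longlongrightarrow> 0) (at_right 0)"
    "continuous_on {0<..} \<psi>" "(\<psi> \<longlongrightarrow> 0) (at_right 0)" "\<And>r. r > 0 \<Longrightarrow> \<psi> r \<ge> 0"
    "\<And>s r. s \<in> {0<..<S} \<Longrightarrow> m s < r \<Longrightarrow> s \<le> \<Psi> r"
proof -
  have e_le: "s / m s \<le> 1" "0 \<le> s / m s" if "s \<in> {0<..<S}" for s
    using le[OF that] m_pos[OF that] that by (auto simp: divide_simps)
  obtain w where w: "continuous_on {0..} w" "w 0 = 0" "mono_on {0..} w"
      "\<And>r s. s \<in> {0<..<S} \<Longrightarrow> m s \<le> r \<Longrightarrow> s / m s \<le> w r"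
    using continuous_envelope[OF \<open>0 < S\<close> m_mono m_pos e_le(2) e_le(1) lim] by metis
  have w_nonneg: "0 \<le> w r" if "r \<ge> 0" for r
    using mono_onD[OF w(3), of 0 r] that w(2) by simp
  define I where "I = (\<lambda>x. integral {0..x} w)"
  have cont: "continuous_on {0..b} w" for b
    by (rule continuous_on_subset[OF w(1)]) auto
  have dI: "(I has_real_derivative w r) (at r)" if "r > 0" for r
    unfolding I_def
    by (rule primitive_of_continuous(1)[OF cont[of "r + 1"]]) (use that in auto)
  have I0: "((\<lambda>r. I r / r) \<longlongrightarrow> 0) (at_right 0)"
    using primitive_of_continuous(2)[OF cont[of 1]] w(2) by (simp add: I_def)
  have dbl: "filterlim (\<lambda>r::real. 2 * r) (at_right 0) (at_right 0)"
    unfolding filterlim_at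
    by (auto intro!: tendsto_eq_intros simp: eventually_at_filter)
  have w_lim: "(w \<longlongrightarrow> 0) (at_right 0)"
  proof -
    have "(w \<longlongrightarrow> w 0) (at 0 within {0..})"
      using w(1) by (simp add: continuous_on_def)
    then show ?thesis using w(2) by (auto intro: tendsto_within_subset)
  qed
  show thesis
  \<comment> \<open>Integrating up to \<open>2 * r\<close> leaves the interval from \<open>r\<close>
    to \<open>2 * r\<close>, on which the non-decreasing \<open>w\<close> is at least
    \<open>w r\<close>; hence \<open>I (2 * r) \<ge> r * w r\<close>, and this is at least
    \<open>s\<close> when \<open>m s < r\<close>.\<close>
  proof (rule that[of "\<lambda>r. I (2 * r)" "\<lambda>r. 2 * w (2 * r)"])
    show "I (2 * 0) = 0" by (simp add: I_def)
    show "((\<lambda>r. I (2 * r)) has_real_derivative 2 * w (2 * r)) (at r)" if "r > 0" for r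
    proof -
      have "((\<lambda>r. I (2 * r)) has_real_derivative w (2 * r) * 2) (at r)"
        by (rule DERIV_chain2[OF dI]) (use that in \<open>auto intro!: derivative_eq_intros\<close>)
      then show ?thesis by (simp add: mult.commute)
    qed
    show "mono_on {0..} (\<lambda>r. I (2 * r))"
      unfolding I_def
      by (intro mono_onI integral_subset_le integrable_continuous_interval cont) (auto intro: w_nonneg)
    show "((\<lambda>r. I (2 * r) / r) \<longlongrightarrow> 0) (at_right 0)"
      using tendsto_mult_left[OF filterlim_compose[OF I0 dbl], of 2] by (simp add: divide_simps)
    show "continuous_on {0<..} (\<lambda>r. 2 * w (2 * r))"
      by (intro continuous_intros continuous_on_compose2[OF w(1)]) auto
    show "((\<lambda>r. 2 * w (2 * r)) \<longlongrightarrow> 0) (at_right 0)"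
      using tendsto_mult_left[OF filterlim_compose[OF w_lim dbl], of 2] by simp
    show "0 \<le> 2 * w (2 * r)" if "r > 0" for r using w_nonneg that by simp
    show "s \<le> I (2 * r)" if s: "s \<in> {0<..<S}" and r: "m s < r" for s r
    proof -
      have r0: "r > 0" using m_pos[OF s] r by simp
      have "s = (s / m s) * m s" using m_pos[OF s] by simp
      also have "\<dots> \<le> w r * r"
        using w(4)[OF s, of r] w_nonneg[of r] r r0 m_pos[OF s] by (intro mult_mono) auto
      also have "\<dots> = integral {r..2 * r} (\<lambda>_. w r)" using r0 by simp
      also have "\<dots> \<le> integral {r..2 * r} w"
        using r0 by (intro integral_le integrable_continuous_interval continuous_on_const
            continuous_on_subset[OF w(1)] mono_onD[OF w(3)]) auto
      also have "\<dots> \<le> integral {0..r} w + integral {r..2 * r} w"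
        using r0 w_nonneg
        by (intro add_increasing integral_nonneg integrable_continuous_interval cont) auto
      also have "\<dots> = I (2 * r)"
        unfolding I_def using r0
        by (intro Henstock_Kurzweil_Integration.integral_combine integrable_continuous_interval cont) auto
      finally show ?thesis .
    qed
  qed
qed

section \<open>The profile equation, solved by separation of variables\<close>

text \<open>The integrability hypothesis makes the primitive of the singular quotient continuous up
  to 0; the substitution \<open>\<zeta> = sqrt N * q\<close> then removes \<open>N\<close>.\<close>

lemma weighted_primitive:
  fixes g :: "real \<Rightarrow> real"
  assumes N: "N > 0" and cont: "continuous_on {0..} g"
    and int: "\<forall>\<xi>>0. set_integrable lborel {0<..\<xi>} (\<lambda>\<zeta>. g (\<zeta>\<^sup>2 / N) / \<zeta>)"
  obtains G where "continuous_on {0..} G" "G 0 = 0"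
    "\<And>q. q > 0 \<Longrightarrow> (G has_real_derivative g (q\<^sup>2) / q) (at q)"
proof -
  define f where "f = (\<lambda>\<zeta>. g (\<zeta>\<^sup>2 / N) / \<zeta>)"
  define I where "I = (\<lambda>x. integral {0..x} f)"
  have f_int: "f integrable_on {0..b}" if "b > 0" for b
  proof -
    have "set_integrable lborel {0<..<b} f"
      unfolding f_def by (rule set_integrable_subset[of _ "{0<..b}"]) (use int that in auto)
    then have "f integrable_on {0<..<b}"
      by (rule set_borel_integral_eq_integral)
    then show ?thesis
      by (simp add: integrable_on_open_interval_real)
  qed
  have "continuous (at x within {0..}) I" if "x \<ge> 0" for x
  proof -
    have "continuous_on {0..x + 1} I"
      unfolding I_def by (rule indefinite_integral_continuous_1[OF f_int]) (use that in auto)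
    then have "continuous (at x within {0..x + 1}) I"
      using that by (simp add: continuous_on_eq_continuous_within)
    moreover have "at x within {0..x + 1} = at x within {0..}"
      by (rule at_within_nhd[of _ "{..<x + 1}"]) (use that in auto)
    ultimately show ?thesis by simp
  qed
  then have I_cont: "continuous_on {0..} I"
    by (simp add: continuous_on_eq_continuous_within)
  have I_der: "(I has_real_derivative f x) (at x)" if "x > 0" for x
  proof -
    have "continuous_on {0<..} f"
      unfolding f_def using N by (intro continuous_intros continuous_on_compose2[OF cont]) auto
    then have "continuous (at x) f"
      using that by (simp add: continuous_on_eq_continuous_at)
    then have "((\<lambda>u. integral {0..u} f) has_vector_derivative f x) (at x within ({0..x + 1} - {}))"
      using that by (intro integral_has_vector_derivative_continuous_at f_int)
        (auto intro: continuous_within_subset)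
    then show ?thesis
      using that by (simp add: I_def at_within_Icc_at has_real_derivative_iff_has_vector_derivative)
  qed
  show thesis
  proof (rule that[of "\<lambda>q. I (sqrt N * q)"])
    show "continuous_on {0..} (\<lambda>q. I (sqrt N * q))"
      using N by (intro continuous_on_compose2[OF I_cont] continuous_intros) auto
    show "I (sqrt N * 0) = 0" by (simp add: I_def)
    show "((\<lambda>q. I (sqrt N * q)) has_real_derivative g (q\<^sup>2) / q) (at q)" if "q > 0" for q
    proof -
      have "((\<lambda>q. I (sqrt N * q)) has_real_derivative f (sqrt N * q) * sqrt N) (at q)"
        by (rule DERIV_chain2[OF I_der]) (use that N in \<open>auto intro!: derivative_eq_intros\<close>)
      moreover have "f (sqrt N * q) * sqrt N = g (q\<^sup>2) / q"
        using that N by (simp add: f_def power_mult_distrib)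
      ultimately show ?thesis by simp
    qed
  qed
qed

text \<open>The inverse function of \<open>G\<close> solves \<open>p' = 1 / G'(p)\<close>. As
  \<open>G\<close> is continuous at 0 with \<open>G 0 = 0\<close>, this solution starts at the value
  0 and becomes positive immediately.\<close>

lemma inverse_from_origin:
  fixes G G' :: "real \<Rightarrow> real"
  assumes cont: "continuous_on {0..P} G" and G0: "G 0 = 0" and P: "P > 0"
    and der: "\<And>q. q \<in> {0<..<P} \<Longrightarrow> (G has_real_derivative G' q) (at q)"
    and pos: "\<And>q. q \<in> {0<..<P} \<Longrightarrow> G' q > 0"
  obtains S p where "S > 0" "continuous_on {0..S} p" "p 0 = 0"
    "\<And>s. s \<in> {0<..<S} \<Longrightarrow> p s \<in> {0<..<P} \<and> G (p s) = s \<and>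
       (p has_real_derivative inverse (G' (p s))) (at s)"
    "strict_mono_on {0..S} p"
proof -
  have G_less: "G a < G b" if "0 \<le> a" "a < b" "b \<le> P" for a b
  proof (rule DERIV_pos_imp_increasing_open[OF that(2)])
    show "\<exists>y. (G has_real_derivative y) (at x) \<and> 0 < y" if "a < x" "x < b" for x
      using der[of x] pos[of x] that \<open>0 \<le> a\<close> \<open>b \<le> P\<close> by auto
    show "continuous_on {a..b} G" by (rule continuous_on_subset[OF cont]) (use that in auto)
  qed
  have inj: "inj_on G {0..P}"
    by (rule linorder_inj_onI) (use G_less in \<open>auto simp: less_imp_neq\<close>)
  define S where "S = G P"
  define p where "p = the_inv_into {0..P} G"
  have S: "S > 0" using G_less[of 0 P] P G0 by (simp add: S_def)
  have img: "G ` {0..P} = {0..S}"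
  proof
    show "G ` {0..P} \<subseteq> {0..S}"
      using G_less[of 0] G_less[of _ P] G0 P unfolding S_def
      by (fastforce simp: order_le_less)
    show "{0..S} \<subseteq> G ` {0..P}"
      using IVT'[of G 0 _ P] cont P G0 by (force simp: S_def)
  qed
  have p_cont: "continuous_on {0..S} p"
    using continuous_on_inv_into[OF cont compact_Icc inj] by (simp add: img p_def)
  have Gp: "G (p s) = s" "p s \<in> {0..P}" if "s \<in> {0..S}" for s
    using that f_the_inv_into_f[OF inj, of s] the_inv_into_into[OF inj _ order_refl, of s] img
    by (auto simp: p_def)
  have p0: "p 0 = 0"
    using the_inv_into_f_f[OF inj, of 0] P by (simp add: p_def G0)
  have smono: "strict_mono_on {0..S} p"
  proof (rule strict_mono_onI)
    fix r s assume rs: "r \<in> {0..S}" "s \<in> {0..S}" "r < s"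
    then show "p r < p s"
      using Gp[OF rs(1)] Gp[OF rs(2)] G_less[of "p s" "p r"]
      by (metis atLeastAtMost_iff less_asym linorder_neqE_linordered_idom)
  qed
  have main: "p s \<in> {0<..<P} \<and> G (p s) = s \<and> (p has_real_derivative inverse (G' (p s))) (at s)"
    if s: "s \<in> {0<..<S}" for s
  proof -
    have s': "s \<in> {0..S}" using s by auto
    have "p s \<noteq> 0" "p s \<noteq> P" using Gp[OF s'] s G0 by (auto simp: S_def)
    then have ps: "p s \<in> {0<..<P}" using Gp(2)[OF s'] by auto
    have "isCont p s"
      using continuous_on_interior[OF p_cont, of s] s by (simp add: interior_atLeastAtMost_real)
    then have "(p has_real_derivative inverse (G' (p s))) (at s)"
      using s Gp pos[OF ps]
      by (intro DERIV_inverse_function[where f = G and a = 0 and b = S] der ps) auto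
    then show ?thesis using ps Gp[OF s'] by blast
  qed
  show thesis using that[OF S p_cont p0 main smono] .
qed

text \<open>A comparison that asks for no limit of \<open>h\<close> at 0: \<open>h - G\<close> is
  non-decreasing on every interval from \<open>a > 0\<close> to \<open>q\<close>, \<open>h a\<close>
  is non-negative, and \<open>G a\<close> tends to 0 with \<open>a\<close>.\<close>

lemma le_of_derivative_le:
  fixes G h G' h' :: "real \<Rightarrow> real"
  assumes cont: "continuous_on {0..} G" and G0: "G 0 = 0"
    and dG: "\<And>q. q \<in> {0<..<P} \<Longrightarrow> (G has_real_derivative G' q) (at q)"
    and dh: "\<And>q. q \<in> {0<..<P} \<Longrightarrow> (h has_real_derivative h' q) (at q)"
    and h: "\<And>q. q \<in> {0<..<P} \<Longrightarrow> h q \<ge> 0"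
    and le: "\<And>q. q \<in> {0<..<P} \<Longrightarrow> G' q \<le> h' q"
    and q: "q \<in> {0<..<P}"
  shows "G q \<le> h q"
proof -
  have "G q - h q \<le> G a" if a: "0 < a" "a < q" for a
  proof -
    have "(h a - G a) \<le> h q - G q"
    proof (rule DERIV_nonneg_imp_nondecreasing[where f = "\<lambda>x. h x - G x"])
      show "a \<le> q" using a by simp
      fix x assume "a \<le> x" "x \<le> q"
      then have x: "x \<in> {0<..<P}" using a q by auto
      show "\<exists>y. ((\<lambda>x. h x - G x) has_real_derivative y) (at x) \<and> 0 \<le> y"
        using DERIV_diff[OF dh[OF x] dG[OF x]] le[OF x] by force
    qed
    then show ?thesis using h[of a] a q by simp
  qed
  then have ev: "\<forall>\<^sub>F a in at_right 0. G q - h q \<le> G a"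
    using q unfolding eventually_at_right_field by (intro exI[of _ q]) auto
  have "(G \<longlongrightarrow> G 0) (at 0 within {0..})"
    using cont by (simp add: continuous_on_def)
  then have "(G \<longlongrightarrow> 0) (at_right 0)"
    using G0 by (auto intro: tendsto_within_subset)
  from tendsto_lowerbound[OF this ev] show ?thesis by simp
qed

lemma assumption_L_DERIV:
  assumes "assumption_L g g' tb" "t \<in> {0<..<tb}"
  shows "(g has_real_derivative g' t) (at t)"
proof -
  have "\<forall>t\<in>{0<..tb}. (g has_real_derivative g' t) (at t within {0<..tb})"
    using assms(1) unfolding assumption_L_def by blast
  then have "(g has_real_derivative g' t) (at t within {0<..tb})"
    using assms(2) by simp
  then have "(g has_real_derivative g' t) (at t within {0<..<tb})"
    by (rule DERIV_subset) auto
  then show ?thesis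
    using at_within_open[OF assms(2)] by simp
qed

text \<open>With \<open>q = p s\<close> one has \<open>s = G q\<close>, so both growth claims are
  upper bounds for \<open>G q\<close>, by a small multiple of \<open>sqrt (g (q\<^sup>2))\<close> or
  by a fixed multiple of \<open>g (q\<^sup>2)\<close>. Each follows by comparing derivatives in
  \<open>q\<close>.\<close>

lemma radial_profile:
  fixes g g' :: "real \<Rightarrow> real" and tb N :: real
  assumes N: "N > 0" and cont: "continuous_on {0..} g" and nonneg: "\<forall>t\<ge>0. 0 \<le> g t"
    and L: "assumption_L g g' tb"
    and int: "\<forall>\<xi>>0. set_integrable lborel {0<..\<xi>} (\<lambda>\<zeta>. g (\<zeta>\<^sup>2 / N) / \<zeta>)"
    and g'_pos: "\<forall>t\<in>{0<..tb}. 0 < g' t"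
    and lim: "((\<lambda>t. (g t powr (3 / 2)) / (t * g' t)) \<longlongrightarrow> 0) (at_right 0)"
  obtains S p where "S > 0" "continuous_on {0..S} p" "p 0 = 0" "strict_mono_on {0..S} p"
    "\<And>s. s \<in> {0<..<S} \<Longrightarrow> 0 < p s \<and> (p s)\<^sup>2 < tb \<and>
       (p has_real_derivative p s / (4 * g ((p s)\<^sup>2))) (at s)"
    "((\<lambda>s. s / sqrt (g ((p s)\<^sup>2))) \<longlongrightarrow> 0) (at_right 0)"
    "bounded ((\<lambda>t. g t / (t * g' t)) ` {0<..tb}) \<Longrightarrow>
       \<exists>K>0. \<forall>s\<in>{0<..<S}. s \<le> K * g ((p s)\<^sup>2)"
proof -
  have tb: "tb > 0" and g_pos: "\<And>t. t \<in> {0<..tb} \<Longrightarrow> g t > 0"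
    using L unfolding assumption_L_def by blast+
  note dg = assumption_L_DERIV[OF L]
  define P where "P = sqrt tb"
  have P: "P > 0" using tb by (simp add: P_def)
  have sq: "q\<^sup>2 \<in> {0<..<tb}" if "q \<in> {0<..<P}" for q
  proof -
    have "q\<^sup>2 < P\<^sup>2" using that by (intro power_strict_mono) auto
    then show ?thesis using that tb by (simp add: P_def)
  qed
  obtain G0 where G0: "continuous_on {0..} G0" "G0 0 = 0"
      "\<And>q. q > 0 \<Longrightarrow> (G0 has_real_derivative g (q\<^sup>2) / q) (at q)"
    using weighted_primitive[OF N cont int] by blast
  \<comment> \<open>The factor 4 becomes the 4 in the equation for \<open>p\<close>; it provides the
    slack in \<open>supersolution_inequality\<close>.\<close>
  define G where "G = (\<lambda>q. 4 * G0 q)"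
  have G_cont: "continuous_on {0..} G" unfolding G_def by (intro continuous_intros G0)
  have G_zero: "G 0 = 0" by (simp add: G_def G0)
  have dG: "(G has_real_derivative 4 * g (q\<^sup>2) / q) (at q)" if "q \<in> {0<..<R}" for q R
    unfolding G_def using DERIV_cmult[OF G0(3), of q 4] that by simp
  have dG_pos: "4 * g (q\<^sup>2) / q > 0" if "q \<in> {0<..<P}" for q
    using g_pos[of "q\<^sup>2"] sq[OF that] that by auto
  have dsq: "((\<lambda>q. g (q\<^sup>2)) has_real_derivative 2 * q * g' (q\<^sup>2)) (at q)" if "q \<in> {0<..<P}" for q
  proof -
    have "((\<lambda>q. q\<^sup>2) has_real_derivative 2 * q) (at q)"
      by (auto intro!: derivative_eq_intros)
    from DERIV_chain2[where f = g, OF dg[OF sq[OF that]] this] show ?thesis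
      by (simp add: mult_ac)
  qed
  have G_cont': "continuous_on {0..P} G" by (rule continuous_on_subset[OF G_cont]) auto
  obtain S p where S: "S > 0" and p_cont: "continuous_on {0..S} p" and p0: "p 0 = 0"
    and p: "\<And>s. s \<in> {0<..<S} \<Longrightarrow> p s \<in> {0<..<P} \<and> G (p s) = s \<and>
       (p has_real_derivative inverse (4 * g ((p s)\<^sup>2) / p s)) (at s)"
    and p_mono: "strict_mono_on {0..S} p"
    using inverse_from_origin[OF G_cont' G_zero P dG[where R = P] dG_pos] by blast
  have p_lim: "((\<lambda>s. s / sqrt (g ((p s)\<^sup>2))) \<longlongrightarrow> 0) (at_right 0)"
  proof (rule tendstoI)
    fix \<epsilon> :: real assume \<epsilon>: "\<epsilon> > 0"
    \<comment> \<open>With \<open>g\<close> and \<open>g'\<close> taken at \<open>q\<^sup>2\<close>,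
      the required inequality \<open>4 * g / q \<le> \<epsilon> / 2 * (q * g' / sqrt g)\<close>
      amounts to \<open>g powr (3 / 2) / (q\<^sup>2 * g') \<le> \<epsilon> / 8\<close>.\<close>
    have "\<forall>\<^sub>F t in at_right 0. (g t powr (3 / 2)) / (t * g' t) < \<epsilon> / 8"
      using order_tendstoD(2)[OF lim, of "\<epsilon> / 8"] \<epsilon> by simp
    then obtain b where b: "b > 0"
        "\<And>t. 0 < t \<Longrightarrow> t < b \<Longrightarrow> (g t powr (3 / 2)) / (t * g' t) < \<epsilon> / 8"
      unfolding eventually_at_right_field by auto
    define d where "d = min P (sqrt b)"
    have d: "d > 0" using P b by (simp add: d_def)
    have d_P: "q \<in> {0<..<P}" if "q \<in> {0<..<d}" for q using that by (auto simp: d_def)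
    have G_le: "G q \<le> \<epsilon> / 2 * sqrt (g (q\<^sup>2))" if "q \<in> {0<..<d}" for q
    proof (rule le_of_derivative_le[where h = "\<lambda>q. \<epsilon> / 2 * sqrt (g (q\<^sup>2))" and
          h' = "\<lambda>q. \<epsilon> / 2 * (q * g' (q\<^sup>2) / sqrt (g (q\<^sup>2)))", OF G_cont G_zero dG _ _ _ that])
      fix q assume q: "q \<in> {0<..<d}"
      have q2: "q\<^sup>2 \<in> {0<..<tb}" by (rule sq[OF d_P[OF q]])
      have gp: "g (q\<^sup>2) > 0" "g' (q\<^sup>2) > 0" using g_pos g'_pos q2 by auto
      have "((\<lambda>q. sqrt (g (q\<^sup>2))) has_real_derivative
          inverse (sqrt (g (q\<^sup>2))) / 2 * (2 * q * g' (q\<^sup>2))) (at q)"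
        by (rule DERIV_chain2[where f = sqrt, OF DERIV_real_sqrt[OF gp(1)] dsq[OF d_P[OF q]]])
      then have "((\<lambda>q. \<epsilon> / 2 * sqrt (g (q\<^sup>2))) has_real_derivative
          \<epsilon> / 2 * (inverse (sqrt (g (q\<^sup>2))) / 2 * (2 * q * g' (q\<^sup>2)))) (at q)"
        by (rule DERIV_cmult)
      moreover have "\<epsilon> / 2 * (inverse (sqrt (g (q\<^sup>2))) / 2 * (2 * q * g' (q\<^sup>2)))
          = \<epsilon> / 2 * (q * g' (q\<^sup>2) / sqrt (g (q\<^sup>2)))"
        by (simp add: inverse_eq_divide)
      ultimately show "((\<lambda>q. \<epsilon> / 2 * sqrt (g (q\<^sup>2))) has_real_derivative
          \<epsilon> / 2 * (q * g' (q\<^sup>2) / sqrt (g (q\<^sup>2)))) (at q)"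
        by (simp only:)
      show "0 \<le> \<epsilon> / 2 * sqrt (g (q\<^sup>2))" using gp \<epsilon> by simp
      have "q\<^sup>2 < (sqrt b)\<^sup>2" using q by (intro power_strict_mono) (auto simp: d_def)
      then have "0 < q\<^sup>2" "q\<^sup>2 < b" using b(1) q by auto
      then have "(g (q\<^sup>2) powr (3 / 2)) / (q\<^sup>2 * g' (q\<^sup>2)) < \<epsilon> / 8"
        by (rule b(2))
      moreover have "g (q\<^sup>2) powr (3 / 2) = g (q\<^sup>2) * sqrt (g (q\<^sup>2))"
        using gp powr_add[of "g (q\<^sup>2)" 1 "1 / 2"] by (simp add: powr_half_sqrt)
      ultimately have "g (q\<^sup>2) * sqrt (g (q\<^sup>2)) < \<epsilon> / 8 * (q\<^sup>2 * g' (q\<^sup>2))"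
        using gp q by (simp add: pos_divide_less_eq)
      then have "4 * g (q\<^sup>2) * sqrt (g (q\<^sup>2)) / (q * sqrt (g (q\<^sup>2)))
          \<le> \<epsilon> / 2 * (q\<^sup>2 * g' (q\<^sup>2)) / (q * sqrt (g (q\<^sup>2)))"
        using gp q by (intro divide_right_mono) auto
      then show "4 * g (q\<^sup>2) / q \<le> \<epsilon> / 2 * (q * g' (q\<^sup>2) / sqrt (g (q\<^sup>2)))"
        using gp q by (simp add: power2_eq_square)
    qed
    have "(p \<longlongrightarrow> p 0) (at 0 within {0..S})"
      using p_cont S by (simp add: continuous_on_def)
    then have "(p \<longlongrightarrow> 0) (at_right 0)"
      using S p0 by (simp add: at_within_Icc_at_right)
    then have "\<forall>\<^sub>F s in at_right 0. p s < d" using d by (rule order_tendstoD)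
    moreover have "\<forall>\<^sub>F s in at_right 0. s \<in> {0<..<S}"
      using eventually_at_right_real[OF S] .
    ultimately show "\<forall>\<^sub>F s in at_right 0. dist (s / sqrt (g ((p s)\<^sup>2))) 0 < \<epsilon>"
    proof eventually_elim
      case (elim s)
      note ps = p[OF elim(2)]
      then have "s \<le> \<epsilon> / 2 * sqrt (g ((p s)\<^sup>2))" using G_le[of "p s"] elim by auto
      moreover have gp: "g ((p s)\<^sup>2) > 0" using g_pos sq[of "p s"] ps by auto
      ultimately have "s / sqrt (g ((p s)\<^sup>2)) \<le> \<epsilon> / 2" by (simp add: pos_divide_le_eq)
      then have "s / sqrt (g ((p s)\<^sup>2)) < \<epsilon>" using \<epsilon> by linarith
      moreover have "0 \<le> s / sqrt (g ((p s)\<^sup>2))" using elim gp by simp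
      ultimately show ?case by (simp only: dist_real_def)
    qed
  qed
  have p_bdd: "\<exists>K>0. \<forall>s\<in>{0<..<S}. s \<le> K * g ((p s)\<^sup>2)"
    if bdd: "bounded ((\<lambda>t. g t / (t * g' t)) ` {0<..tb})"
  proof -
    obtain K where K: "K > 0" "\<And>t. t \<in> {0<..tb} \<Longrightarrow> \<bar>g t / (t * g' t)\<bar> \<le> K"
      using bdd unfolding bounded_pos by auto
    \<comment> \<open>The derivative of \<open>2 * K * g (q\<^sup>2)\<close> is
      \<open>4 * K * q * g' (q\<^sup>2)\<close>, which dominates
      \<open>4 * g (q\<^sup>2) / q\<close> exactly when
      \<open>g (q\<^sup>2) / (q\<^sup>2 * g' (q\<^sup>2)) \<le> K\<close>.\<close>
    have "s \<le> (2 * K) * g ((p s)\<^sup>2)" if s: "s \<in> {0<..<S}" for s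
    proof -
      have "G (p s) \<le> (2 * K) * g ((p s)\<^sup>2)"
      proof (rule le_of_derivative_le[where h = "\<lambda>q. (2 * K) * g (q\<^sup>2)" and
          h' = "\<lambda>q. (2 * K) * (2 * q * g' (q\<^sup>2))" and P = P, OF G_cont G_zero dG])
        fix q assume q: "q \<in> {0<..<P}"
        have q2: "q\<^sup>2 \<in> {0<..tb}" using sq[OF q] by auto
        have gp: "g (q\<^sup>2) > 0" "g' (q\<^sup>2) > 0" using g_pos g'_pos q2 by auto
        show "((\<lambda>q. (2 * K) * g (q\<^sup>2)) has_real_derivative (2 * K) * (2 * q * g' (q\<^sup>2))) (at q)"
          by (rule DERIV_cmult[OF dsq[OF q]])
        show "0 \<le> (2 * K) * g (q\<^sup>2)" using gp K by simp
        have "g (q\<^sup>2) / (q\<^sup>2 * g' (q\<^sup>2)) \<le> K" using K(2)[OF q2] by linarith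
        then show "4 * g (q\<^sup>2) / q \<le> (2 * K) * (2 * q * g' (q\<^sup>2))"
          using gp q by (simp add: divide_simps power2_eq_square mult_ac)
      qed (use p[OF s] in auto)
      then show ?thesis using p[OF s] by simp
    qed
    then show ?thesis using K by (intro exI[of _ "2 * K"]) auto
  qed
  have p_ode: "0 < p s \<and> (p s)\<^sup>2 < tb \<and> (p has_real_derivative p s / (4 * g ((p s)\<^sup>2))) (at s)"
    if "s \<in> {0<..<S}" for s
    using p[OF that] sq[of "p s"] by auto
  show thesis by (rule that[OF S p_cont p0 p_mono p_ode p_lim p_bdd])
qed

section \<open>Regions tangent to the unit sphere at the pole\<close>

text \<open>Away from 0 this is the chain rule. At 0 the convention \<open>sgn 0 = 0\<close> makes
  the stated gradient vanish, which is correct because \<open>\<Psi> r / r\<close> tends to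
  0.\<close>

lemma has_derivative_radial:
  fixes w :: "'a::real_inner" and \<Psi> \<psi> :: "real \<Rightarrow> real"
  assumes "\<Psi> 0 = 0" and der: "\<And>r. r > 0 \<Longrightarrow> (\<Psi> has_real_derivative \<psi> r) (at r)"
    and lim: "((\<lambda>r. \<Psi> r / r) \<longlongrightarrow> 0) (at_right 0)"
  shows "((\<lambda>w. \<Psi> (norm w)) has_derivative (\<lambda>v. (\<psi> (norm w) *\<^sub>R sgn w) \<bullet> v)) (at w)"
proof (cases "w = 0")
  case True
  have norm_lim: "filterlim (norm :: 'a \<Rightarrow> real) (at_right 0) (at 0)"
    unfolding filterlim_at by (auto intro!: tendsto_eq_intros simp: eventually_at_filter)
  have "((\<lambda>h::'a. \<Psi> (norm h) / norm h) \<longlongrightarrow> 0) (at 0)"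
    by (rule filterlim_compose[OF lim norm_lim])
  from tendsto_norm[OF this] have "((\<lambda>h::'a. norm (\<Psi> (norm h)) / norm h) \<longlongrightarrow> 0) (at 0)"
    by simp
  then show ?thesis
    using True assms(1) by (simp add: has_derivative_at)
next
  case False
  then have "((\<lambda>w. \<Psi> (norm w)) has_derivative (\<lambda>v. (v \<bullet> sgn w) * \<psi> (norm w))) (at w)"
    by (intro DERIV_compose_FDERIV der has_derivative_norm) simp_all
  then show ?thesis
    by (simp add: inner_commute mult.commute)
qed

lemma continuous_radial_gradient:
  fixes \<psi> :: "real \<Rightarrow> real"
  assumes cont: "continuous_on {0<..} \<psi>" and lim: "(\<psi> \<longlongrightarrow> 0) (at_right 0)"
  shows "continuous_on UNIV (\<lambda>w::'a::real_inner. \<psi> (norm w) *\<^sub>R sgn w)"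
proof (intro continuous_at_imp_continuous_on ballI)
  fix w :: 'a
  show "isCont (\<lambda>w. \<psi> (norm w) *\<^sub>R sgn w) w"
  proof (cases "w = 0")
    case True
    have norm_lim: "filterlim (norm :: 'a \<Rightarrow> real) (at_right 0) (at 0)"
      unfolding filterlim_at by (auto intro!: tendsto_eq_intros simp: eventually_at_filter)
    have "((\<lambda>w::'a. \<psi> (norm w)) \<longlongrightarrow> 0) (at 0)"
      by (rule filterlim_compose[OF lim norm_lim])
    then have "((\<lambda>w::'a. \<psi> (norm w) *\<^sub>R sgn w) \<longlongrightarrow> 0) (at 0)"
      by (rule Lim_null_comparison[rotated, OF tendsto_rabs_zero])
         (auto intro!: always_eventually simp: norm_sgn)
    then show ?thesis using True by (simp add: isCont_def)
  next
    case False
    then have "isCont \<psi> (norm w)"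
      using cont by (simp add: continuous_on_eq_continuous_at)
    with False show ?thesis
      by (intro continuous_intros isCont_o2[where f = norm and g = \<psi>] isCont_sgn) auto
  qed
qed

text \<open>A ball of radius \<open>R\<close>, internally tangent to the unit sphere at
  \<open>e\<close>, thinned according to the distance \<open>r\<close> from the axis. With
  \<open>y = 1 - x \<bullet> e\<close> the condition reads
  \<open>(r\<^sup>2 + y\<^sup>2) / (2 * R) + \<Psi> r < y\<close>, which is why
  \<open>\<Psi>\<close> carries the factor \<open>2 * R\<close>.\<close>

definition cap_region :: "'a::real_inner \<Rightarrow> real \<Rightarrow> (real \<Rightarrow> real) \<Rightarrow> 'a set" where
  "cap_region e R \<Psi> =
     {x. (norm (x - (1 - R) *\<^sub>R e))\<^sup>2 + 2 * R * \<Psi> (norm (x - (x \<bullet> e) *\<^sub>R e)) - R\<^sup>2 < 0}"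

lemma cap_region_zero: "R > 0 \<Longrightarrow> cap_region e R (\<lambda>_. 0) = ball ((1 - R) *\<^sub>R e) R"
  unfolding cap_region_def
  by (auto simp: dist_norm norm_minus_commute abs_le_square_iff[symmetric] not_less[symmetric]
      dest: power2_less_imp_less intro: power_strict_mono)

text \<open>These bounds translate the region into the depth \<open>1 - norm x\<close>. The fourth
  controls the region obtained from a majorant \<open>\<Psi>\<close>, the fifth the plain ball; both
  come from one lower bound for \<open>1 - (norm x)\<^sup>2\<close>, which is at most
  \<open>2 * (1 - norm x)\<close>.\<close>

lemma cap_region_bounds:
  fixes e :: "'a::real_inner"
  assumes e: "norm e = 1" and R: "0 < R" "R \<le> 1/4"
    and \<Psi>: "\<And>r. r \<ge> 0 \<Longrightarrow> \<Psi> r \<ge> 0" and x: "x \<in> cap_region e R \<Psi>"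
  defines "r \<equiv> norm (x - (x \<bullet> e) *\<^sub>R e)"
  shows "1 - 2 * R < norm x" "norm x < 1" "r < R" "\<Psi> r < 1 - norm x"
    "(1 / R - 1) * r\<^sup>2 / 2 < 1 - norm x"
proof -
  define y where "y = 1 - x \<bullet> e"
  have ee: "e \<bullet> e = 1" using e by (simp add: dot_square_norm)
  have r2: "r\<^sup>2 = x \<bullet> x - (x \<bullet> e)\<^sup>2"
    unfolding r_def power2_norm_eq_inner
    by (simp add: inner_diff_left inner_diff_right ee inner_commute power2_eq_square)
  have nc: "(norm (x - (1 - R) *\<^sub>R e))\<^sup>2 = r\<^sup>2 + (R - y)\<^sup>2"
    unfolding r2 power2_norm_eq_inner y_def
    by (simp add: inner_diff_left inner_diff_right ee inner_commute power2_eq_square algebra_simps)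
  have nx: "(norm x)\<^sup>2 = r\<^sup>2 + (1 - y)\<^sup>2"
    unfolding r2 y_def power2_norm_eq_inner by simp
  have r0: "r \<ge> 0" by (simp add: r_def)
  have \<Psi>r: "\<Psi> r \<ge> 0" using \<Psi> r0 by blast
  have main: "r\<^sup>2 + (R - y)\<^sup>2 + 2 * R * \<Psi> r < R\<^sup>2"
    using x nc unfolding cap_region_def r_def by simp
  have "2 * R * \<Psi> r \<ge> 0" using R \<Psi>r by simp
  then have lt: "r\<^sup>2 + (R - y)\<^sup>2 < R\<^sup>2" using main by linarith
  then have "r\<^sup>2 < R\<^sup>2" by (smt (verit) zero_le_power2)
  then show "r < R" using R r0 by (simp add: power2_less_imp_less)
  have "(norm (x - (1 - R) *\<^sub>R e))\<^sup>2 < R\<^sup>2" using lt nc by simp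
  then have "norm (x - (1 - R) *\<^sub>R e) < R" using R by (simp add: power2_less_imp_less)
  moreover have "norm ((1 - R) *\<^sub>R e) = 1 - R" using R e by simp
  ultimately show nx_lo: "1 - 2 * R < norm x" and nx_hi: "norm x < 1"
    using norm_triangle_ineq3[of x "(1 - R) *\<^sub>R e"] norm_triangle_ineq2[of x "(1 - R) *\<^sub>R e"] by auto
  \<comment> \<open>Dividing the defining inequality by \<open>R\<close> isolates
    \<open>2 * y\<close>, the leading term of
    \<open>1 - (norm x)\<^sup>2 = 2 * y - y\<^sup>2 - r\<^sup>2\<close>.\<close>
  have "(1 / R) * (r\<^sup>2 + y\<^sup>2 + 2 * R * \<Psi> r) < (1 / R) * (2 * R * y)"
    using main R by (intro mult_strict_left_mono) (auto simp: power2_eq_square algebra_simps)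
  then have "(1 / R) * (r\<^sup>2 + y\<^sup>2) + 2 * \<Psi> r < 2 * y"
    using R by (simp add: field_simps)
  moreover have "(1 / R - 1) * y\<^sup>2 \<ge> 0" using R by simp
  ultimately have "(1 / R - 1) * r\<^sup>2 + 2 * \<Psi> r < 1 - (norm x)\<^sup>2"
    unfolding nx by (simp add: power2_eq_square algebra_simps)
  also have "1 - (norm x)\<^sup>2 = (1 - norm x) * (1 + norm x)"
    by (simp add: power2_eq_square algebra_simps)
  also have "\<dots> \<le> (1 - norm x) * 2"
    using nx_hi by (intro mult_left_mono) auto
  finally have fin: "(1 / R - 1) * r\<^sup>2 + 2 * \<Psi> r < (1 - norm x) * 2" .
  have "(1 / R - 1) * r\<^sup>2 \<ge> 0" using R by simp
  moreover have "b < t \<and> a / 2 < t" if "a + 2 * b < t * 2" "0 \<le> a" "0 \<le> b" for a b t :: real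
    using that by simp
  ultimately show "\<Psi> r < 1 - norm x" "(1 / R - 1) * r\<^sup>2 / 2 < 1 - norm x"
    using fin \<Psi>r by blast+
qed

text \<open>Pairing the gradient of the defining function with \<open>x - c\<close> gives
  \<open>2 * (norm (x - c))\<^sup>2\<close> plus a non-negative term, so the gradient can vanish
  only at the centre \<open>c\<close>, where the function equals \<open>- R\<^sup>2\<close>. The
  general results on sublevel sets then apply.\<close>

lemma cap_region_regular:
  fixes e :: "'a::euclidean_space"
  assumes e: "norm e = 1" and R: "0 < R"
    and \<Psi>0: "\<Psi> 0 = 0" and der: "\<And>r. r > 0 \<Longrightarrow> (\<Psi> has_real_derivative \<psi> r) (at r)"
    and mono: "mono_on {0..} \<Psi>" and lim: "((\<lambda>r. \<Psi> r / r) \<longlongrightarrow> 0) (at_right 0)"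
    and cont: "continuous_on {0<..} \<psi>" and lim': "(\<psi> \<longlongrightarrow> 0) (at_right 0)"
    and pos: "\<And>r. r > 0 \<Longrightarrow> \<psi> r \<ge> 0"
  shows "regular_region (cap_region e R \<Psi>)" "e \<in> frontier (cap_region e R \<Psi>)"
    "outer_unit_normal (cap_region e R \<Psi>) e e"
proof -
  define c where "c = (1 - R) *\<^sub>R e"
  define w where "w = (\<lambda>x. x - (x \<bullet> e) *\<^sub>R e)"
  define q where "q = (\<lambda>x. \<psi> (norm (w x)) *\<^sub>R sgn (w x))"
  define H where "H = (\<lambda>x. (norm (x - c))\<^sup>2 + 2 * R * \<Psi> (norm (w x)) - R\<^sup>2)"
  define D where "D = (\<lambda>x. 2 *\<^sub>R (x - c) + (2 * R) *\<^sub>R q x)"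
  have cap: "cap_region e R \<Psi> = {x. H x < 0}"
    by (simp add: cap_region_def H_def c_def w_def)
  have ee: "e \<bullet> e = 1" using e by (simp add: dot_square_norm)
  have we: "w x \<bullet> e = 0" for x by (simp add: w_def inner_diff_left ee)
  have qe: "q x \<bullet> e = 0" for x by (simp add: q_def sgn_div_norm we)
  have wc: "w c = 0" "w e = 0" by (simp_all add: w_def c_def ee)
  have w_lin: "w (c + t *\<^sub>R (x - c)) = t *\<^sub>R w x" for t x
    by (simp add: w_def c_def inner_add_left inner_diff_left ee algebra_simps)
  have \<Psi>_nonneg: "\<Psi> r \<ge> 0" if "r \<ge> 0" for r
    using mono_onD[OF mono, of 0 r] that \<Psi>0 by simp
  have derH: "(H has_derivative (\<lambda>v. D x \<bullet> v)) (at x)" for x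
  proof -
    have "(w has_derivative (\<lambda>v. v - (v \<bullet> e) *\<^sub>R e)) (at x)"
      unfolding w_def by (auto intro!: derivative_eq_intros)
    then have "((\<lambda>x. \<Psi> (norm (w x))) has_derivative (\<lambda>v. q x \<bullet> (v - (v \<bullet> e) *\<^sub>R e))) (at x)"
      unfolding q_def
      by (rule has_derivative_compose[OF _ has_derivative_radial[OF \<Psi>0 der lim]])
    then have 1: "((\<lambda>x. \<Psi> (norm (w x))) has_derivative (\<lambda>v. q x \<bullet> v)) (at x)"
      by (simp add: inner_diff_right qe)
    have 2: "((\<lambda>x. (norm (x - c))\<^sup>2) has_derivative (\<lambda>v. (2 *\<^sub>R (x - c)) \<bullet> v)) (at x)"
      unfolding power2_norm_eq_inner
      by (auto intro!: derivative_eq_intros simp: inner_commute)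
    show ?thesis
      using has_derivative_diff[OF has_derivative_add[OF 2 has_derivative_mult_right[OF 1, of "2 * R"]]
          has_derivative_const[of "R\<^sup>2"]]
      by (simp add: H_def D_def inner_add_left)
  qed
  have D_nz: "D x \<noteq> 0" if "H x = 0" for x
  proof
    assume "D x = 0"
    \<comment> \<open>The part of \<open>x - c\<close> along the axis is orthogonal to
      \<open>sgn (w x)\<close>, so only \<open>w x\<close> contributes to the pairing.\<close>
    have xw: "x - c = w x + (x \<bullet> e - (1 - R)) *\<^sub>R e"
      by (simp add: w_def c_def algebra_simps)
    have "sgn (w x) \<bullet> (x - c) = sgn (w x) \<bullet> w x"
      unfolding xw by (simp add: inner_add_right sgn_div_norm we)
    also have "\<dots> = norm (w x)"
      by (cases "w x = 0") (auto simp: sgn_div_norm dot_square_norm power2_eq_square)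
    finally have "q x \<bullet> (x - c) = \<psi> (norm (w x)) * norm (w x)"
      by (simp add: q_def)
    also have "\<dots> \<ge> 0" using pos[of "norm (w x)"] by (cases "w x = 0") auto
    finally have "(2 * R) * (q x \<bullet> (x - c)) \<ge> 0" using R by simp
    moreover have "D x \<bullet> (x - c) = 2 * (norm (x - c))\<^sup>2 + (2 * R) * (q x \<bullet> (x - c))"
      by (simp add: D_def inner_add_left dot_square_norm)
    moreover have "D x \<bullet> (x - c) = 0" using \<open>D x = 0\<close> by simp
    ultimately have "(norm (x - c))\<^sup>2 \<le> 0" by linarith
    then have "x = c" by simp
    then have "H x = - R\<^sup>2" by (simp add: H_def wc \<Psi>0)
    with that R show False by simp
  qed
  have "continuous_on UNIV q"
    unfolding q_def
    by (rule continuous_on_compose2[OF continuous_radial_gradient[OF cont lim']])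
       (auto simp: w_def intro!: continuous_intros)
  then have D_cont: "continuous_on UNIV D"
    unfolding D_def by (intro continuous_intros)
  have "c \<in> {x. H x < 0}" using R by (simp add: H_def wc \<Psi>0)
  \<comment> \<open>The region is star-shaped about \<open>c\<close>: moving towards
    \<open>c\<close> shrinks both the distance to \<open>c\<close> and, as \<open>c\<close> lies on
    the axis, the distance to the axis.\<close>
  moreover have "closed_segment c x \<subseteq> {x. H x < 0}" if x: "x \<in> {x. H x < 0}" for x
  proof
    fix y assume "y \<in> closed_segment c x"
    then obtain t where t: "0 \<le> t" "t \<le> 1" "y = c + t *\<^sub>R (x - c)"
      by (auto simp: closed_segment_def algebra_simps)
    have "(norm (y - c))\<^sup>2 \<le> (norm (x - c))\<^sup>2"
      using t by (intro power_mono) (auto simp: mult_left_le_one_le)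
    moreover have "\<Psi> (norm (w y)) \<le> \<Psi> (norm (w x))"
      using t by (intro mono_onD[OF mono]) (auto simp: w_lin mult_left_le_one_le)
    then have "2 * R * \<Psi> (norm (w y)) \<le> 2 * R * \<Psi> (norm (w x))" using R by simp
    ultimately have "H y \<le> H x" unfolding H_def by linarith
    then show "y \<in> {x. H x < 0}" using x by simp
  qed
  ultimately have "starlike {x. H x < 0}" unfolding starlike_def by blast
  then have conn: "connected {x. H x < 0}" by (rule starlike_imp_connected)
  have "{x. H x < 0} \<subseteq> ball c R"
  proof
    fix x assume "x \<in> {x. H x < 0}"
    moreover have "2 * R * \<Psi> (norm (w x)) \<ge> 0" using R \<Psi>_nonneg by simp
    ultimately have "(norm (x - c))\<^sup>2 < R\<^sup>2" by (auto simp: H_def)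
    then show "x \<in> ball c R" using R by (simp add: dist_norm norm_minus_commute power2_less_imp_less)
  qed
  then have bdd: "bounded {x. H x < 0}" by (rule bounded_subset[OF bounded_ball])
  show "regular_region (cap_region e R \<Psi>)"
    unfolding cap by (rule regular_region_sublevel[OF derH D_nz D_cont conn bdd])
  have ec: "e - c = R *\<^sub>R e" by (simp add: c_def algebra_simps)
  have He: "H e = 0" by (simp add: H_def wc \<Psi>0 ec e)
  then show "e \<in> frontier (cap_region e R \<Psi>)"
    unfolding cap by (simp add: frontier_sublevel[OF derH D_nz])
  have De: "D e = (2 * R) *\<^sub>R e" by (simp add: D_def q_def wc ec)
  then have "D e /\<^sub>R norm (D e) = e" using R e by simp
  then show "outer_unit_normal (cap_region e R \<Psi>) e e"
    unfolding cap using outer_unit_normal_sublevel[OF derH D_nz He] by simp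
qed

section \<open>Radial supersolutions\<close>

lemma partial_of_gradient:
  assumes "(u has_derivative (\<lambda>v. D \<bullet> v)) (at x)"
  shows "partial i u x = D $ i"
proof -
  have "((\<lambda>h. u (x + h *\<^sub>R axis i 1)) has_derivative (\<lambda>h. D \<bullet> (h *\<^sub>R axis i 1))) (at 0)"
    by (rule has_derivative_compose[where f = "\<lambda>h. x + h *\<^sub>R axis i 1"])
       (auto intro!: derivative_eq_intros assms)
  then have "((\<lambda>h. u (x + h *\<^sub>R axis i 1)) has_real_derivative D $ i) (at 0)"
    by (simp add: has_field_derivative_def inner_axis mult_commute_abs)
  then show ?thesis
    unfolding partial_def by (rule DERIV_imp_deriv)
qed

lemma C1_onI:
  assumes der: "\<And>x. x \<in> S \<Longrightarrow> (u has_derivative (\<lambda>v. D x \<bullet> v)) (at x)"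
    and cont: "continuous_on S D"
  shows "C1_on S u"
proof -
  have "u differentiable_on S"
    using der by (meson differentiable_on_def differentiable_def differentiable_at_withinI)
  moreover have "continuous_on S (partial i u)" for i
  proof -
    have "continuous_on S (\<lambda>x. D x $ i)" by (intro continuous_intros cont)
    then show ?thesis
      using partial_of_gradient[OF der] by (simp cong: continuous_on_cong)
  qed
  ultimately show ?thesis unfolding C1_on_def by blast
qed

lemma C2_onI:
  fixes u :: "real ^ 'n \<Rightarrow> real"
  assumes S: "open S" and der: "\<And>x. x \<in> S \<Longrightarrow> (u has_derivative (\<lambda>v. D x \<bullet> v)) (at x)"
    and der2: "\<And>x i. x \<in> S \<Longrightarrow> ((\<lambda>y. D y $ i) has_derivative (\<lambda>v. E i x \<bullet> v)) (at x)"
    and cont: "\<And>i. continuous_on S (E i)"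
  shows "C2_on S u" and "\<And>x i j. x \<in> S \<Longrightarrow> partial j (partial i u) x = E i x $ j"
proof -
  have pd: "(partial i u has_derivative (\<lambda>v. E i x \<bullet> v)) (at x)" if "x \<in> S" for x i
    by (rule has_derivative_transform_within_open[OF der2[OF that] S that])
       (simp add: partial_of_gradient[OF der])
  have "continuous_on S (\<lambda>x. D x $ i)" for i
    by (intro has_derivative_continuous_on[OF has_derivative_at_withinI[OF der2]])
  then have "continuous_on S (\<lambda>x. \<chi> i. D x $ i)"
    by (rule continuous_on_vec_lambda)
  then have "continuous_on S D" by (simp only: vec_lambda_eta)
  then show "C2_on S u"
    unfolding C2_on_def using C1_onI[OF der] C1_onI[OF pd cont] by blast
  show "partial j (partial i u) x = E i x $ j" if "x \<in> S" for x i j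
    by (rule partial_of_gradient[OF pd[OF that]])
qed

lemma radial_C2:
  fixes S :: "(real ^ 'n) set" and W p p' :: "real \<Rightarrow> real"
  assumes S: "open S" "0 \<notin> S"
    and dW: "\<And>x. x \<in> S \<Longrightarrow> (W has_real_derivative p (1 - norm x)) (at (1 - norm x))"
    and dp: "\<And>x. x \<in> S \<Longrightarrow> (p has_real_derivative p' (1 - norm x)) (at (1 - norm x))"
    and cont: "continuous_on S (\<lambda>x. p' (1 - norm x))"
  defines "u \<equiv> \<lambda>x. W (1 - norm x)"
  shows "C2_on S u"
    and "\<And>x i. x \<in> S \<Longrightarrow> partial i u x = - (p (1 - norm x) / norm x) * x $ i"
    and "\<And>x i. x \<in> S \<Longrightarrow> partial i (partial i u) x =
      (p' (1 - norm x) / (norm x)\<^sup>2 + p (1 - norm x) / (norm x)^3) * (x $ i)\<^sup>2 - p (1 - norm x) / norm x"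
proof -
  define D where "D = (\<lambda>x::real ^ 'n. - (p (1 - norm x) / norm x) *\<^sub>R x)"
  \<comment> \<open>Row \<open>i\<close> of the Hessian. Writing \<open>\<rho>\<close> for
    \<open>norm x\<close>, the second derivative is \<open>p'\<close> in the radial direction and
    \<open>- p / \<rho>\<close> in the tangential ones.\<close>
  define E where "E = (\<lambda>i (x::real ^ 'n).
    ((p' (1 - norm x) / (norm x)\<^sup>2 + p (1 - norm x) / (norm x)^3) * x $ i) *\<^sub>R x
      - (p (1 - norm x) / norm x) *\<^sub>R axis i 1)"
  have nz: "x \<noteq> 0" if "x \<in> S" for x using that S by blast
  have dnorm: "((\<lambda>x. 1 - norm x) has_derivative (\<lambda>v. - (v \<bullet> sgn x))) (at x)"
    if "x \<in> S" for x :: "real ^ 'n"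
    using has_derivative_diff[OF has_derivative_const
        has_derivative_norm[OF nz[OF that]], of 1] by simp
  have der: "(u has_derivative (\<lambda>v. D x \<bullet> v)) (at x)" if x: "x \<in> S" for x
  proof -
    have "(u has_derivative (\<lambda>v. - (v \<bullet> sgn x) * p (1 - norm x))) (at x)"
      unfolding u_def by (rule DERIV_compose_FDERIV[OF dW[OF x] dnorm[OF x]])
    moreover have "(\<lambda>v. - (v \<bullet> sgn x) * p (1 - norm x)) = (\<lambda>v. D x \<bullet> v)"
      by (auto simp: D_def sgn_div_norm inner_commute field_simps)
    ultimately show ?thesis by simp
  qed
  have der2: "((\<lambda>y. D y $ i) has_derivative (\<lambda>v. E i x \<bullet> v)) (at x)" if x: "x \<in> S" for x i
  proof -
    have "((\<lambda>x. p (1 - norm x)) has_derivative (\<lambda>v. - (v \<bullet> sgn x) * p' (1 - norm x))) (at x)"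
      by (rule DERIV_compose_FDERIV[OF dp[OF x] dnorm[OF x]])
    note dquot = has_derivative_divide'[OF this has_derivative_norm[OF nz[OF x]]]
    have dcoord: "((\<lambda>y. y $ i) has_derivative (\<lambda>v. v $ i)) (at x)"
      by (intro bounded_linear_imp_has_derivative bounded_linear_vec_nth)
    have "((\<lambda>y. - (p (1 - norm y) / norm y * y $ i)) has_derivative
      (\<lambda>v. - (p (1 - norm x) / norm x * v $ i +
        (- (v \<bullet> sgn x) * p' (1 - norm x) * norm x - p (1 - norm x) * (v \<bullet> sgn x))
        / (norm x * norm x) * x $ i))) (at x)"
      by (rule has_derivative_minus[OF has_derivative_mult[OF dquot dcoord]]) (use nz[OF x] in simp)
    moreover have "(\<lambda>y. D y $ i) = (\<lambda>y. - (p (1 - norm y) / norm y * y $ i))"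
      by (simp add: D_def)
    ultimately have A: "((\<lambda>y. D y $ i) has_derivative
      (\<lambda>v. - (p (1 - norm x) / norm x * v $ i +
        (- (v \<bullet> sgn x) * p' (1 - norm x) * norm x - p (1 - norm x) * (v \<bullet> sgn x))
        / (norm x * norm x) * x $ i))) (at x)"
      by (simp only:)
    have B: "- (p (1 - norm x) / norm x * v $ i +
        (- (v \<bullet> sgn x) * p' (1 - norm x) * norm x - p (1 - norm x) * (v \<bullet> sgn x))
        / (norm x * norm x) * x $ i) = E i x \<bullet> v" for v
    proof -
      have Ev: "E i x \<bullet> v = (p' (1 - norm x) / (norm x)\<^sup>2 + p (1 - norm x) / (norm x)^3) * x $ i * (x \<bullet> v)
          - p (1 - norm x) / norm x * v $ i"
        by (simp add: E_def inner_diff_left inner_axis')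
      have sgn: "v \<bullet> sgn x = (x \<bullet> v) / norm x"
        by (simp add: sgn_div_norm inner_commute divide_inverse_commute)
      \<comment> \<open>Naming the norm \<open>r\<close> and the other quantities turns the claim
        into a rational identity with the single denominator variable \<open>r\<close>.\<close>
      have id: "- (P / r * b + (- (d / r) * q * r - P * (d / r)) / (r * r) * a)
          = (q / r\<^sup>2 + P / r ^ 3) * a * d - P / r * b" if "r \<noteq> 0" for d r q P a b :: real
        using that by (simp add: divide_simps) (simp add: algebra_simps eval_nat_numeral)
      show ?thesis
        unfolding Ev sgn by (rule id) (use nz[OF x] in simp)
    qed
    show ?thesis by (rule has_derivative_eq_rhs[OF A]) (rule ext, rule B)
  qed
  have "continuous_on S (\<lambda>x. p (1 - norm x))"
    by (rule has_derivative_continuous_on)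
       (rule has_derivative_at_withinI, rule DERIV_compose_FDERIV[OF dp dnorm])
  then have E_cont: "continuous_on S (E i)" for i
    unfolding E_def using nz by (intro continuous_intros cont) auto
  show "C2_on S u" by (rule C2_onI[OF S(1) der der2 E_cont])
  show "partial i u x = - (p (1 - norm x) / norm x) * x $ i" if "x \<in> S" for x i
    using partial_of_gradient[OF der[OF that]] by (simp add: D_def)
  show "partial i (partial i u) x =
      (p' (1 - norm x) / (norm x)\<^sup>2 + p (1 - norm x) / (norm x)^3) * (x $ i)\<^sup>2 - p (1 - norm x) / norm x"
    if "x \<in> S" for x i
    using C2_onI(2)[OF S(1) der der2 E_cont that]
    by (simp add: E_def axis_def power2_eq_square)
qed

section \<open>Sign of the operator on the radial function\<close>

text \<open>Here \<open>a\<close> is the squared coordinate along the axis, \<open>b\<close> the sum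
  of the other squares, and \<open>n\<close> is the dimension minus one. Since
  \<open>b + \<gamma> * a \<le> 2 * \<rho>\<^sup>2 * \<Gamma>\<close>, the terms with
  \<open>p'\<close> give at most half of \<open>p / \<rho>\<close>. As
  \<open>\<rho>\<^sup>2 = a + b\<close>, the curvature terms other than
  \<open>- n * (p / \<rho>)\<close> combine to \<open>p / \<rho>^3 * (b - \<gamma> * b)\<close>, at
  most a quarter of \<open>p / \<rho>\<close>. One copy of \<open>p / \<rho>\<close> absorbs
  both.\<close>

lemma supersolution_inequality:
  fixes p \<rho> \<gamma> \<Gamma> a b n :: real
  assumes "0 < \<rho>" "\<rho> \<le> 1" "0 < p" "0 < \<Gamma>" "0 \<le> \<gamma>" "\<gamma> \<le> \<Gamma>" "0 \<le> a" "0 \<le> b"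
    and ab: "a + b = \<rho>\<^sup>2" and b1: "b \<le> \<rho>\<^sup>2 * \<Gamma>" and b2: "b \<le> \<rho>\<^sup>2 / 4" and n: "n \<ge> 1"
  shows "(p / (4 * \<Gamma>) / \<rho>\<^sup>2 + p / \<rho>^3) * b - n * (p / \<rho>)
      + \<gamma> * ((p / (4 * \<Gamma>) / \<rho>\<^sup>2 + p / \<rho>^3) * a - p / \<rho>) \<le> 0"
proof -
  define K L P where "K = p / (4 * \<Gamma>) / \<rho>\<^sup>2" and "L = p / \<rho>^3" and "P = p / \<rho>"
  have "\<gamma> * a \<le> \<Gamma> * \<rho>\<^sup>2" using assms by (intro mult_mono) auto
  then have "b + \<gamma> * a \<le> 2 * \<rho>\<^sup>2 * \<Gamma>" using b1 by (simp add: algebra_simps)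
  then have "p / (4 * \<Gamma>) / \<rho>\<^sup>2 * (b + \<gamma> * a) \<le> p / (4 * \<Gamma>) / \<rho>\<^sup>2 * (2 * \<rho>\<^sup>2 * \<Gamma>)"
    using assms by (intro mult_left_mono) auto
  also have "\<dots> = p / 2" using assms by (simp add: field_simps)
  also have "\<dots> \<le> (p / \<rho>) / 2" using assms by (simp add: field_simps)
  finally have A: "p / (4 * \<Gamma>) / \<rho>\<^sup>2 * (b + \<gamma> * a) \<le> (p / \<rho>) / 2" .
  have "p / \<rho>^3 * (b - \<gamma> * b) \<le> p / \<rho>^3 * (\<rho>\<^sup>2 / 4)"
    using assms mult_nonneg_nonneg[of \<gamma> b] by (intro mult_left_mono) (auto simp del: mult_nonneg_nonneg)
  also have "\<dots> = (p / \<rho>) / 4" using assms by (simp add: field_simps power2_eq_square power3_eq_cube)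
  finally have B: "p / \<rho>^3 * (b - \<gamma> * b) \<le> (p / \<rho>) / 4" .
  have "p / \<rho>^3 * (\<gamma> * \<rho>\<^sup>2) = \<gamma> * (p / \<rho>)"
    using assms by (simp add: field_simps power2_eq_square power3_eq_cube)
  moreover have "\<gamma> * \<rho>\<^sup>2 = \<gamma> * a + \<gamma> * b" using ab by (metis distrib_left)
  ultimately have C: "\<gamma> * (p / \<rho>) = p / \<rho>^3 * (\<gamma> * a) + p / \<rho>^3 * (\<gamma> * b)"
    by (metis distrib_left)
  have "1 * (p / \<rho>) \<le> n * (p / \<rho>)" using n assms by (intro mult_right_mono) auto
  moreover have "p / \<rho> \<ge> 0" using assms by simp
  ultimately show ?thesis
    using A B C unfolding K_def[symmetric] L_def[symmetric] P_def[symmetric]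
    by (simp add: algebra_simps)
qed

lemma norm_diff_axis_sq:
  fixes x :: "real ^ 'n"
  shows "(norm (x - (x \<bullet> axis k 1) *\<^sub>R axis k 1))\<^sup>2 = (\<Sum>i\<in>UNIV - {k}. (x $ i)\<^sup>2)"
proof -
  have "(norm (x - (x \<bullet> axis k 1) *\<^sub>R axis k 1))\<^sup>2
      = (\<Sum>i\<in>UNIV. ((x - (x \<bullet> axis k 1) *\<^sub>R axis k 1) $ i)\<^sup>2)"
    by (simp add: norm_vec_def L2_set_def sum_nonneg)
  also have "\<dots> = (\<Sum>i\<in>UNIV - {k}. ((x - (x \<bullet> axis k 1) *\<^sub>R axis k 1) $ i)\<^sup>2)"
    by (rule sum.mono_neutral_right) (auto simp: inner_axis)
  also have "\<dots> = (\<Sum>i\<in>UNIV - {k}. (x $ i)\<^sup>2)"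
    by (rule sum.cong) (auto simp: axis_def)
  finally show ?thesis .
qed

text \<open>Reduces the theorem to finding a region: the profile is fixed, and besides regularity,
  the normal at the pole and closeness to the sphere, the region only has to keep the distance to
  the axis within the two bounds \<open>r1\<close> and \<open>r2\<close>.\<close>

lemma hopf_counterexample_radial:
  fixes g p :: "real \<Rightarrow> real" and k :: "'n::finite" and \<Omega> :: "(real ^ 'n) set"
  assumes card: "CARD('n) \<ge> 2"
    and g_cont: "continuous_on {0..} g" and g_mono: "mono_on {0..<tb} g"
    and g_nonneg: "\<And>t. t \<ge> 0 \<Longrightarrow> 0 \<le> g t" and g_pos: "\<And>t. 0 < t \<Longrightarrow> t < tb \<Longrightarrow> 0 < g t"
    and S: "S > 0" and p_cont: "continuous_on {0..S} p" and p0: "p 0 = 0"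
    and p: "\<And>s. s \<in> {0<..<S} \<Longrightarrow> 0 < p s \<and> (p s)\<^sup>2 < tb \<and>
       (p has_real_derivative p s / (4 * g ((p s)\<^sup>2))) (at s)"
    and reg: "regular_region \<Omega>" and fr: "axis k 1 \<in> frontier \<Omega>"
    and normal: "outer_unit_normal \<Omega> (axis k 1) (axis k 1)"
    and \<Omega>: "\<And>x. x \<in> \<Omega> \<Longrightarrow> 1 / 2 < norm x \<and> norm x < 1 \<and> 1 - norm x < S"
    and r1: "\<And>x. x \<in> \<Omega> \<Longrightarrow> norm (x - (x \<bullet> axis k 1) *\<^sub>R axis k 1) \<le> 1 / 4"
    and r2: "\<And>x. x \<in> \<Omega> \<Longrightarrow>
      4 * (norm (x - (x \<bullet> axis k 1) *\<^sub>R axis k 1))\<^sup>2 \<le> g ((p (1 - norm x))\<^sup>2)"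
  shows "hopf_counterexample g k \<Omega> (axis k 1) (\<lambda>x. integral {0..1 - norm x} p)"
proof -
  define W where "W = (\<lambda>s. integral {0..s} p)"
  define u where "u = (\<lambda>x::real ^ 'n. W (1 - norm x))"
  let ?e = "axis k 1 :: real ^ 'n"
  have e: "norm ?e = 1" by simp
  have op: "open \<Omega>" using reg by (simp add: regular_region_def)
  have W0: "W 0 = 0" by (simp add: W_def)
  have W_cont: "continuous_on {0..S} W"
    unfolding W_def by (intro indefinite_integral_continuous_1 integrable_continuous_interval p_cont)
  have dW: "(W has_real_derivative p s) (at s)" if "s \<in> {0<..<S}" for s
    unfolding W_def by (rule primitive_of_continuous(1)[OF p_cont S that])
  have W_pos: "W s > 0" if s: "s \<in> {0<..<S}" for s
  proof -
    have "W 0 < W s"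
    proof (rule DERIV_pos_imp_increasing_open[where f = W])
      show "0 < s" using s by simp
      show "\<exists>y. (W has_real_derivative y) (at x) \<and> 0 < y" if "0 < x" "x < s" for x
        using dW[of x] p[of x] s that by auto
      show "continuous_on {0..s} W" by (rule continuous_on_subset[OF W_cont]) (use s in auto)
    qed
    then show ?thesis by (simp add: W0)
  qed
  have s_in: "1 - norm x \<in> {0<..<S}" if "x \<in> \<Omega>" for x using \<Omega>[OF that] by auto
  define p' where "p' = (\<lambda>s. p s / (4 * g ((p s)\<^sup>2)))"
  have p_\<Omega>: "continuous_on \<Omega> (\<lambda>x. p (1 - norm x))"
    by (rule continuous_on_compose2[OF p_cont]) (use s_in in \<open>force intro!: continuous_intros\<close>)+
  have g_p_pos: "g ((p s)\<^sup>2) > 0" if "s \<in> {0<..<S}" for s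
    using p[OF that] g_pos by simp
  have "continuous_on \<Omega> (\<lambda>x. g ((p (1 - norm x))\<^sup>2))"
    by (rule continuous_on_compose2[OF g_cont]) (auto intro!: continuous_intros p_\<Omega>)
  then have p'_\<Omega>: "continuous_on \<Omega> (\<lambda>x. p' (1 - norm x))"
    unfolding p'_def using g_p_pos[OF s_in]
    by (intro continuous_intros p_\<Omega>) (auto simp: less_imp_neq[THEN not_sym])
  have zero: "0 \<notin> \<Omega>" using \<Omega>[of 0] by auto
  have dp: "(p has_real_derivative p' s) (at s)" if "s \<in> {0<..<S}" for s
    using p[OF that] by (simp add: p'_def)
  have dW_norm: "(W has_real_derivative p (1 - norm x)) (at (1 - norm x))"
    and dp_norm: "(p has_real_derivative p' (1 - norm x)) (at (1 - norm x))" if "x \<in> \<Omega>" for x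
    using dW[OF s_in[OF that]] dp[OF s_in[OF that]] .
  have C2: "C2_on \<Omega> u"
    unfolding u_def by (rule radial_C2[OF op zero dW_norm dp_norm p'_\<Omega>])
  have first: "partial i u x = - (p (1 - norm x) / norm x) * x $ i" if "x \<in> \<Omega>" for x i
    unfolding u_def by (rule radial_C2(2)[OF op zero dW_norm dp_norm p'_\<Omega> that])
  have second: "partial i (partial i u) x =
      (p' (1 - norm x) / (norm x)\<^sup>2 + p (1 - norm x) / (norm x)^3) * (x $ i)\<^sup>2 - p (1 - norm x) / norm x"
    if "x \<in> \<Omega>" for x i
    unfolding u_def by (rule radial_C2(3)[OF op zero dW_norm dp_norm p'_\<Omega> that])
  have F: "F_op g k u x \<le> 0" if x: "x \<in> \<Omega>" for x
  proof -
    define \<rho> P b a \<gamma> \<Gamma> M where "\<rho> = norm x" and "P = p (1 - \<rho>)"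
      and "b = (\<Sum>i\<in>UNIV - {k}. (x $ i)\<^sup>2)" and "a = (x $ k)\<^sup>2"
      and "\<gamma> = g ((- (P / \<rho>) * x $ k)\<^sup>2)" and "\<Gamma> = g (P\<^sup>2)"
      and "M = P / (4 * \<Gamma>) / \<rho>\<^sup>2 + P / \<rho>^3"
    have \<rho>: "1 / 2 < \<rho>" "\<rho> < 1" using \<Omega>[OF x] by (auto simp: \<rho>_def)
    have P: "P > 0" "P\<^sup>2 < tb" using p[OF s_in[OF x]] by (auto simp: P_def \<rho>_def)
    have \<Gamma>: "\<Gamma> > 0" using g_p_pos[OF s_in[OF x]] by (simp add: \<Gamma>_def P_def \<rho>_def)
    have b_eq: "b = (norm (x - (x \<bullet> ?e) *\<^sub>R ?e))\<^sup>2"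
      unfolding b_def norm_diff_axis_sq ..
    have ab: "a + b = \<rho>\<^sup>2"
      unfolding a_def b_def \<rho>_def
      by (simp add: norm_vec_def L2_set_def sum_nonneg sum.remove[of UNIV k])
    have b0: "b \<ge> 0" by (simp add: b_eq)
    have a0: "a \<ge> 0" by (simp add: a_def)
    \<comment> \<open>As \<open>norm x\<close> exceeds one half, \<open>4 * b \<le> \<Gamma>\<close>
      implies \<open>b \<le> \<rho>\<^sup>2 * \<Gamma>\<close>, and \<open>b \<le> 1 / 16\<close>
      implies \<open>b \<le> \<rho>\<^sup>2 / 4\<close>.\<close>
    have "1 / 4 < \<rho>\<^sup>2" using \<rho> power_strict_mono[of "1 / 2" \<rho> 2] by (simp add: power2_eq_square)
    moreover have "4 * b \<le> \<Gamma>" using r2[OF x] by (simp add: b_eq \<Gamma>_def P_def \<rho>_def)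
    moreover have "1 / 4 * \<Gamma> \<le> \<rho>\<^sup>2 * \<Gamma>"
      using \<open>1 / 4 < \<rho>\<^sup>2\<close> \<Gamma> by (intro mult_right_mono) auto
    ultimately have b1: "b \<le> \<rho>\<^sup>2 * \<Gamma>" by linarith
    have "b \<le> (1 / 4)\<^sup>2" unfolding b_eq using r1[OF x] by (intro power_mono) auto
    then have b2: "b \<le> \<rho>\<^sup>2 / 4" using \<open>1 / 4 < \<rho>\<^sup>2\<close> by (simp add: power2_eq_square)
    have arg: "(- (P / \<rho>) * x $ k)\<^sup>2 = P\<^sup>2 * (a / \<rho>\<^sup>2)"
      by (simp add: a_def power_mult_distrib power_divide)
    \<comment> \<open>The derivative along the axis is at most the full gradient \<open>P\<close> in
      absolute value, so monotonicity of \<open>g\<close> gives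
      \<open>\<gamma> \<le> \<Gamma>\<close>.\<close>
    have "a / \<rho>\<^sup>2 \<le> 1" using ab b0 \<rho> by (simp add: divide_simps)
    then have "P\<^sup>2 * (a / \<rho>\<^sup>2) \<le> P\<^sup>2" using mult_left_mono[of "a / \<rho>\<^sup>2" 1 "P\<^sup>2"] by simp
    moreover have "0 \<le> P\<^sup>2 * (a / \<rho>\<^sup>2)" using a0 by simp
    ultimately have \<gamma>: "\<gamma> \<le> \<Gamma>" "0 \<le> \<gamma>"
      unfolding \<gamma>_def \<Gamma>_def arg using P by (auto intro!: mono_onD[OF g_mono] g_nonneg)
    have M: "partial i (partial i u) x = M * (x $ i)\<^sup>2 - P / \<rho>" for i
      using second[OF x, of i] by (simp add: M_def P_def \<rho>_def p'_def \<Gamma>_def)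
    have "(\<Sum>i\<in>UNIV - {k}. partial i (partial i u) x) = M * b - real (CARD('n) - 1) * (P / \<rho>)"
      by (simp add: M sum_subtractf sum_distrib_left[symmetric] b_def card_Diff_singleton)
    moreover have "g ((partial k u x)\<^sup>2) = \<gamma>"
      using first[OF x, of k] by (simp add: \<gamma>_def P_def \<rho>_def)
    ultimately have "F_op g k u x
        = M * b - real (CARD('n) - 1) * (P / \<rho>) + \<gamma> * (M * a - P / \<rho>)"
      unfolding F_op_def by (simp add: M a_def)
    also have "\<dots> \<le> 0"
      unfolding M_def using card \<rho> P \<Gamma> \<gamma> a0 b0 ab b1 b2
      by (intro supersolution_inequality) auto
    finally show ?thesis .
  qed
  have u_e: "u ?e = 0" by (simp add: u_def W0)
  have u_cont: "continuous (at ?e within \<Omega>) u"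
  proof -
    \<comment> \<open>Adjoining the pole adds only the depth 0, which still lies in the domain of
      continuity of \<open>W\<close>.\<close>
    have "continuous_on (insert ?e \<Omega>) u"
      unfolding u_def using s_in S
      by (intro continuous_on_compose2[OF W_cont] continuous_intros) force
    then have "continuous (at ?e within insert ?e \<Omega>) u"
      by (simp add: continuous_on_eq_continuous_within)
    then show ?thesis by (rule continuous_within_subset) auto
  qed
  have normal_der: "has_normal_derivative u 0 ?e ?e"
  proof -
    have "((\<lambda>h. - (W h / h)) \<longlongrightarrow> 0) (at_right 0)"
      using tendsto_minus[OF primitive_of_continuous(2)[OF p_cont S]] p0 by (simp add: W_def)
    moreover have "\<forall>\<^sub>F h in at_right 0. - (W h / h) = (u ?e - u (?e - h *\<^sub>R ?e)) / h"
    proof -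
      \<comment> \<open>Along the inner normal the depth is exactly \<open>h\<close>, so the
        difference quotient is \<open>- (W h / h)\<close>, with limit
        \<open>- p 0 = 0\<close>.\<close>
      have "norm (?e - h *\<^sub>R ?e) = 1 - h" if "0 < h" "h < 1" for h
        using that norm_scaleR[of "1 - h" ?e] by (simp add: scaleR_left_diff_distrib)
      then show ?thesis
        unfolding eventually_at_right_field
        by (intro exI[of _ 1]) (simp add: u_def W0)
    qed
    ultimately show ?thesis
      unfolding has_normal_derivative_def by (rule Lim_transform_eventually)
  qed
  have "radial_on \<Omega> u" unfolding radial_on_def u_def by (intro exI[of _ "\<lambda>r. W (1 - r)"]) simp
  then have "hopf_counterexample g k \<Omega> ?e u"
    unfolding hopf_counterexample_def
    using reg fr C2 u_cont F u_e W_pos[OF s_in] normal normal_der by (auto simp: u_def)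
  then show ?thesis by (simp add: u_def W_def)
qed

section \<open>Choice of the two regions\<close>

theorem theorem2:
  fixes g g' :: "real \<Rightarrow> real" and tb :: real and k :: "'n::finite"
  assumes "CARD('n) \<ge> 2"
    and "continuous_on {0..} g" and "\<forall>t\<ge>0. 0 \<le> g t"
    and "assumption_L g g' tb" and "assumption_G g"
    and "\<forall>\<xi>>0. set_integrable lborel {0<..\<xi>} (\<lambda>\<zeta>. g (\<zeta>\<^sup>2 / real CARD('n)) / \<zeta>)"
    and "\<forall>t\<in>{0<..tb}. 0 < g' t \<and> g t + g' t * t \<le> 1"
    and "((\<lambda>t. (g t powr (3 / 2)) / (t * g' t)) \<longlongrightarrow> 0) (at_right 0)"
  shows "(\<exists>\<Omega> z u. hopf_counterexample g k \<Omega> z u) \<and>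
    (bounded ((\<lambda>t. g t / (t * g' t)) ` {0<..tb}) \<longrightarrow>
      (\<exists>\<Omega> z u. hopf_counterexample g k \<Omega> z u \<and> interior_ball_condition \<Omega> z))"
proof -
  let ?e = "axis k 1 :: real ^ 'n"
  let ?r = "\<lambda>x::real ^ 'n. norm (x - (x \<bullet> ?e) *\<^sub>R ?e)"
  have e: "norm ?e = 1" by simp
  have g_pos: "0 < g t" if "0 < t" "t < tb" for t
    using assms(4) that unfolding assumption_L_def by simp
  have g_mono: "mono_on {0..<tb} g"
  proof (rule mono_onI)
    fix a b assume ab: "a \<in> {0..<tb}" "b \<in> {0..<tb}" "a \<le> b"
    show "g a \<le> g b"
    proof (rule DERIV_nonneg_imp_increasing_open[OF \<open>a \<le> b\<close>])
      fix t assume t: "a < t" "t < b"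
      then have t': "t \<in> {0<..<tb}" "t \<in> {0<..tb}" using ab by auto
      have "(g has_real_derivative g' t) (at t)"
        by (rule assumption_L_DERIV[OF assms(4) t'(1)])
      moreover have "0 \<le> g' t" using assms(7) t'(2) by (simp add: less_imp_le)
      ultimately show "\<exists>y. (g has_real_derivative y) (at t) \<and> 0 \<le> y" by blast
    qed (use ab in \<open>auto intro: continuous_on_subset[OF assms(2)]\<close>)
  qed
  have N: "real CARD('n) > 0" by simp
  have g'_pos: "\<forall>t\<in>{0<..tb}. 0 < g' t" using assms(7) by blast
  obtain S p where S: "S > 0" and p_cont: "continuous_on {0..S} p" and p0: "p 0 = 0"
    and p_mono: "strict_mono_on {0..S} p"
    and p: "\<And>s. s \<in> {0<..<S} \<Longrightarrow> 0 < p s \<and> (p s)\<^sup>2 < tb \<and>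
       (p has_real_derivative p s / (4 * g ((p s)\<^sup>2))) (at s)"
    and p_lim: "((\<lambda>s. s / sqrt (g ((p s)\<^sup>2))) \<longlongrightarrow> 0) (at_right 0)"
    and p_bdd: "bounded ((\<lambda>t. g t / (t * g' t)) ` {0<..tb}) \<Longrightarrow>
       \<exists>K>0. \<forall>s\<in>{0<..<S}. s \<le> K * g ((p s)\<^sup>2)"
    using radial_profile[OF N assms(2,3,4,6) g'_pos assms(8)] by blast
  \<comment> \<open>Both regions are instances of \<open>cap_region\<close>. What remains for each
    of them is \<open>small\<close>, the smallness of the angle to the axis.\<close>
  have counterexample: "hopf_counterexample g k (cap_region ?e R \<Psi>) ?e (\<lambda>x. integral {0..1 - norm x} p)"
    if R: "0 < R" "R < 1/4" "2 * R \<le> S" and \<Psi>0: "\<Psi> 0 = 0"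
      and der: "\<And>r. r > 0 \<Longrightarrow> (\<Psi> has_real_derivative \<psi> r) (at r)"
      and mono: "mono_on {0..} \<Psi>" and lim: "((\<lambda>r. \<Psi> r / r) \<longlongrightarrow> 0) (at_right 0)"
      and cont: "continuous_on {0<..} \<psi>" and lim': "(\<psi> \<longlongrightarrow> 0) (at_right 0)"
      and pos: "\<And>r. r > 0 \<Longrightarrow> \<psi> r \<ge> 0"
      and small: "\<And>x. x \<in> cap_region ?e R \<Psi> \<Longrightarrow> 4 * (?r x)\<^sup>2 \<le> g ((p (1 - norm x))\<^sup>2)"
    for R :: real and \<Psi> \<psi> :: "real \<Rightarrow> real"
  proof -
    have \<Psi>_nonneg: "\<Psi> r \<ge> 0" if "r \<ge> 0" for r
      using mono_onD[OF mono, of 0 r] that \<Psi>0 by simp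
    note reg = cap_region_regular[OF e R(1) \<Psi>0 der mono lim cont lim' pos]
    note bounds = cap_region_bounds[OF e R(1) less_imp_le[OF R(2)] \<Psi>_nonneg]
    show ?thesis
    proof (rule hopf_counterexample_radial[OF assms(1,2) g_mono _ g_pos S p_cont p0 p reg _ _ small])
      fix x assume x: "x \<in> cap_region ?e R \<Psi>"
      show "1 / 2 < norm x \<and> norm x < 1 \<and> 1 - norm x < S"
        using bounds(1,2)[OF _ x] R by auto
      show "?r x \<le> 1 / 4"
        using bounds(3)[OF _ x] R by simp
    qed (use assms(3) in auto)
  qed
  have g_p_pos: "g ((p s)\<^sup>2) > 0" if "s \<in> {0<..<S}" for s
    using p[OF that] g_pos by simp
  have "\<exists>\<Omega> z u. hopf_counterexample g k \<Omega> z u"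
  proof -
    \<comment> \<open>The condition \<open>4 * r\<^sup>2 \<le> g ((p s)\<^sup>2)\<close> for
      \<open>r \<ge> 0\<close> is \<open>r \<le> m s\<close>.\<close>
    define m where "m = (\<lambda>s. sqrt (g ((p s)\<^sup>2)) / 2)"
    have "\<forall>\<^sub>F s in at_right 0. s / sqrt (g ((p s)\<^sup>2)) < 1 / 2"
      using order_tendstoD(2)[OF p_lim, of "1 / 2"] by simp
    then obtain b where b: "b > 0" "\<And>s. 0 < s \<Longrightarrow> s < b \<Longrightarrow> s / sqrt (g ((p s)\<^sup>2)) < 1 / 2"
      unfolding eventually_at_right_field by auto
    \<comment> \<open>Below \<open>b\<close> the quotient
      \<open>s / sqrt (g ((p s)\<^sup>2))\<close> is less than one half, that is
      \<open>s < m s\<close>, as \<open>C1_majorant\<close> needs.\<close>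
    define T where "T = min b S"
    have T: "T > 0" using b S by (simp add: T_def)
    have T_S: "s \<in> {0<..<S}" if "s \<in> {0<..<T}" for s using that by (auto simp: T_def)
    have m_pos: "m s > 0" if "s \<in> {0<..<T}" for s
      using g_p_pos[OF T_S[OF that]] by (simp add: m_def)
    have m_ge: "s \<le> m s" if "s \<in> {0<..<T}" for s
      using b(2)[of s] that g_p_pos[OF T_S[OF that]] by (simp add: m_def T_def divide_simps)
    have m_mono: "mono_on {0<..<T} m"
    proof (rule mono_onI)
      fix s t assume st: "s \<in> {0<..<T}" "t \<in> {0<..<T}" "s \<le> t"
      have "p s \<le> p t"
        using strict_mono_on_leD[OF p_mono] T_S[OF st(1)] T_S[OF st(2)] st(3) by auto
      then have "(p s)\<^sup>2 \<le> (p t)\<^sup>2" using p[OF T_S[OF st(1)]] by (intro power_mono) auto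
      then have "g ((p s)\<^sup>2) \<le> g ((p t)\<^sup>2)"
        using p[OF T_S[OF st(1)]] p[OF T_S[OF st(2)]] by (intro mono_onD[OF g_mono]) auto
      then show "m s \<le> m t" by (simp add: m_def)
    qed
    have m_lim: "((\<lambda>s. s / m s) \<longlongrightarrow> 0) (at_right 0)"
      using tendsto_mult_left[OF p_lim, of 2] by (simp add: m_def mult.commute)
    obtain \<Psi> \<psi> where \<Psi>: "\<Psi> 0 = 0"
      "\<And>r. r > 0 \<Longrightarrow> (\<Psi> has_real_derivative \<psi> r) (at r)" "mono_on {0..} \<Psi>"
      "((\<lambda>r. \<Psi> r / r) \<longlongrightarrow> 0) (at_right 0)" "continuous_on {0<..} \<psi>" "(\<psi> \<longlongrightarrow> 0) (at_right 0)"
      "\<And>r. r > 0 \<Longrightarrow> \<psi> r \<ge> 0" "\<And>s r. s \<in> {0<..<T} \<Longrightarrow> m s < r \<Longrightarrow> s \<le> \<Psi> r"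
      using C1_majorant[OF T m_mono m_pos m_ge m_lim] by blast
    \<comment> \<open>The depth of a point of the region is below \<open>2 * R\<close>, so
      \<open>R \<le> T / 2\<close> keeps it in the range where \<open>\<Psi>\<close> controls
      \<open>m\<close>.\<close>
    define R where "R = min (1/8) (T / 2)"
    have R: "0 < R" "R < 1/4" "2 * R \<le> T" "2 * R \<le> S" using T by (auto simp: R_def T_def)
    have \<Psi>_nonneg: "\<Psi> r \<ge> 0" if "r \<ge> 0" for r
      using mono_onD[OF \<Psi>(3), of 0 r] that \<Psi>(1) by simp
    have "4 * (?r x)\<^sup>2 \<le> g ((p (1 - norm x))\<^sup>2)" if x: "x \<in> cap_region ?e R \<Psi>" for x
    proof -
      note bounds = cap_region_bounds[OF e R(1) less_imp_le[OF R(2)] \<Psi>_nonneg x]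
      have s: "1 - norm x \<in> {0<..<T}" using bounds(1,2) R by auto
      \<comment> \<open>Otherwise the majorant property would give
        \<open>1 - norm x \<le> \<Psi> (?r x)\<close>, against the fourth bound.\<close>
      have "?r x \<le> m (1 - norm x)"
        using \<Psi>(8)[OF s, of "?r x"] bounds(4) by linarith
      then have "(?r x)\<^sup>2 \<le> (m (1 - norm x))\<^sup>2" by (intro power_mono) auto
      then show ?thesis using g_p_pos[OF T_S[OF s]] by (simp add: m_def power_divide)
    qed
    from counterexample[OF R(1,2,4) \<Psi>(1-7) this] show ?thesis by blast
  qed
  moreover have "\<exists>\<Omega> z u. hopf_counterexample g k \<Omega> z u \<and> interior_ball_condition \<Omega> z"
    if bdd: "bounded ((\<lambda>t. g t / (t * g' t)) ` {0<..tb})"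
  proof -
    obtain K where K: "K > 0" "\<And>s. s \<in> {0<..<S} \<Longrightarrow> s \<le> K * g ((p s)\<^sup>2)"
      using p_bdd[OF bdd] by blast
    \<comment> \<open>\<open>R \<le> 1 / (8 * K + 1)\<close> means
      \<open>8 * K \<le> 1 / R - 1\<close>: the ball is so small that the quadratic depth bound,
      half of \<open>(1 / R - 1) * r\<^sup>2\<close>, dominates
      \<open>K * (4 * r\<^sup>2)\<close>.\<close>
    define R where "R = min (1/8) (min (S / 2) (1 / (8 * K + 1)))"
    have R: "0 < R" "R < 1/4" "2 * R \<le> S" "R \<le> 1 / (8 * K + 1)"
      using S K by (auto simp: R_def)
    have RK: "8 * K \<le> 1 / R - 1" using R K by (simp add: field_simps)
    \<comment> \<open>For \<open>\<Psi> = 0\<close> the region is itself a ball with the pole on its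
      boundary, so it serves as its own interior ball.\<close>
    let ?B = "cap_region ?e R (\<lambda>_. 0)"
    have "4 * (?r x)\<^sup>2 \<le> g ((p (1 - norm x))\<^sup>2)" if x: "x \<in> ?B" for x
    proof -
      note bounds = cap_region_bounds[OF e R(1) less_imp_le[OF R(2)] _ x]
      have s: "1 - norm x \<in> {0<..<S}" using bounds(1,2) R by auto
      have "8 * K * (?r x)\<^sup>2 \<le> (1 / R - 1) * (?r x)\<^sup>2"
        using RK by (intro mult_right_mono) auto
      then have "K * (4 * (?r x)\<^sup>2) \<le> (1 / R - 1) * (?r x)\<^sup>2 / 2" by simp
      also have "\<dots> < 1 - norm x" using bounds(5) by simp
      also have "\<dots> \<le> K * g ((p (1 - norm x))\<^sup>2)" by (rule K(2)[OF s])
      finally show ?thesis using K(1) by simp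
    qed
    from counterexample[where \<Psi> = "\<lambda>_. 0" and \<psi> = "\<lambda>_. 0", OF R(1-3) _ _ _ _ _ _ _ this]
    have H: "hopf_counterexample g k ?B ?e (\<lambda>x. integral {0..1 - norm x} p)"
      by (simp add: mono_on_def)
    then have "?e \<in> frontier (ball ((1 - R) *\<^sub>R ?e) R)"
      using R by (simp add: hopf_counterexample_def cap_region_zero)
    then have "interior_ball_condition ?B ?e"
      unfolding interior_ball_condition_def cap_region_zero[OF R(1)] using R(1) by blast
    with H show ?thesis by blast
  qed
  ultimately show ?thesis by blast
qed

end
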